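(* For all $r,s\in\mathbb{N}_0$, the tensor valuation $T_{r,s}:\mathcal{K}^3\to\mathbb{T}^{r+s+2}(\mathbb{R}^3)$, $T_{r,s}(K)=\widetilde\phi^{r,s,0}(K,\Sigma^3)$, is identically zero; that is, $T_{r,s}(K)=0$ for all $K\in\mathcal{K}^3$.
   Context: $\mathbb{R}^3$ carries its standard scalar product $\langle\cdot,\cdot\rangle$ and a fixed orientation; $\times$ is the vector product. $\Sigma^3=\mathbb{R}^3\times\mathbb{S}^2$, $\mathcal{B}(\Sigma^3)$ is its Borel $\sigma$-algebra, $\mathcal{H}^k$ is $k$-dimensional Hausdorff measure. $\mathcal{K}^3$ is the set of convex bodies (nonempty compact convex subsets) of $\mathbb{R}^3$ with the Hausdorff metric, $\mathcal{P}^3$ the subset of polytopes. $\mathcal{F}_1(P)$ is the set of one-dimensional faces (edges) of the polytope $P$, and $\nu(P,F)$ is the set of outer unit normal vectors of $P$ at its face $F$ (the intersection of the normal cone of $P$ at $F$ with $\mathbb{S}^2$). $\mathbb{T}^p=\mathbb{T}^p(\mathbb{R}^3)$ is the space of symmetric rank $p$ tensors on $\mathbb{R}^3$, viewed as symmetric $p$-linear functionals; a vector $a$ is identified with $\langle a,\cdot\rangle$, products of vectors are symmetric tensor products, $x^r$ is the $r$-fold symmetric product and $x^0=1$. For $P\in\mathcal{P}^3$, $\eta\in\mathcal{B}(\Sigma^3)$, $$\widetilde\phi^{r,s,0}(P,\eta)=\sum_{F\in\mathcal{F}_1(P)}v_F\int_F\int_{\nu(P,F)}\mathbf{1}_\eta(x,u)\,x^r(v_F\times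 u)u^s\,\mathcal{H}^1(du)\,\mathcal{H}^1(dx),$$ where $v_F$ is either of the two unit vectors parallel to $F$ (the choice is irrelevant). This mapping has a unique weakly continuous extension, as a tensor-valued measure in the second argument, to $\mathcal{K}^3\times\mathcal{B}(\Sigma^3)$, denoted by the same symbol; here a mapping $\Gamma$, with each $\Gamma(K,\cdot)$ a tensor-valued measure, is weakly continuous if $\int_{\Sigma^3}f\,d\Gamma(K_i,\cdot)\to\int_{\Sigma^3}f\,d\Gamma(K,\cdot)$ for every sequence $K_i\to K$ in $\mathcal{K}^3$ and every continuous $f:\Sigma^3\to\mathbb{R}$. In particular, for a polytope $P$, $T_{r,s}(P)=\sum_{F\in\mathcal{F}_1(P)}v_F\int_Fx^r\,\mathcal{H}^1(dx)\int_{\nu(P,F)}(v_F\times u)u^s\,\mathcal{H}^1(du)$. *)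

theory Defs
  imports "HOL-Analysis.Analysis" "HOL-Combinatorics.Permutations"
begin

section \<open>Symmetric tensors\<close>

text \<open>
  A rank \<open>p\<close> tensor is a \<open>p\<close>-linear functional, represented as a function on lists of
  vectors which is evaluated at lists of length \<open>p\<close> and vanishes at lists of any other length.
  Tensors of all ranks thus live in one type, and real-valued operations (sums, integrals,
  limits) on tensors of a fixed rank are taken pointwise.
\<close>

type_synonym tensor = "(real^3) list \<Rightarrow> real"

definition sym_tensors :: "nat \<Rightarrow> tensor set" where
  "sym_tensors p = {T.
     (\<forall>ys. length ys \<noteq> p \<longrightarrow> T ys = 0) \<and>
     (\<forall>ys i. length ys = p \<and> i < p \<longrightarrow> linear (\<lambda>y. T (ys[i := y]))) \<and>
     (\<forall>ys \<sigma>. length ys = p \<and> \<sigma> permutes {..<p} \<longrightarrow> T (permute_list \<sigma> ys) = T ys)}"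

definition vec_tensor :: "real^3 \<Rightarrow> tensor" where
  "vec_tensor a = (\<lambda>ys. if length ys = 1 then a \<bullet> hd ys else 0)"

definition one_tensor :: tensor where
  "one_tensor = (\<lambda>ys. if ys = [] then 1 else 0)"

text \<open>
  If \<open>S\<close> has rank \<open>p\<close> and \<open>T\<close> has rank \<open>q\<close>, only the summands with \<open>k = p\<close> and
  \<open>length ys = p + q\<close> survive, so that this is the usual symmetrization
  \<open>(1 / (p+q)!) \<Sum>\<^sub>\<sigma> S (y\<^bsub>\<sigma>(1)\<^esub>, \<dots>, y\<^bsub>\<sigma>(p)\<^esub>) T (y\<^bsub>\<sigma>(p+1)\<^esub>, \<dots>, y\<^bsub>\<sigma>(p+q)\<^esub>)\<close>.
\<close>

definition sym_prod :: "tensor \<Rightarrow> tensor \<Rightarrow> tensor"  (infixr \<open>\<odot>\<close> 75) where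
  "S \<odot> T = (\<lambda>ys.
     (\<Sum>\<sigma> | \<sigma> permutes {..<length ys}. \<Sum>k\<le>length ys.
        S (take k (permute_list \<sigma> ys)) * T (drop k (permute_list \<sigma> ys)))
     / fact (length ys))"

primrec sym_power :: "real^3 \<Rightarrow> nat \<Rightarrow> tensor" where
  "sym_power x 0 = one_tensor"
| "sym_power x (Suc r) = vec_tensor x \<odot> sym_power x r"

section \<open>Hausdorff measure\<close>

text \<open>
  Normalized as usual by the volume of the \<open>k\<close>-dimensional unit ball, so that \<open>k = 1\<close> gives
  length. Pieces must be bounded because \<open>diameter\<close> is meaningful only for bounded sets; empty
  pieces never contribute (which matters only for \<open>k = 0\<close>).
\<close>

definition hausdorff_content :: "nat \<Rightarrow> real \<Rightarrow> 'a::metric_space set \<Rightarrow> ennreal" where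
  "hausdorff_content k \<delta> A =
     (INF C \<in> {C :: nat \<Rightarrow> 'a set. A \<subseteq> (\<Union>i. C i) \<and> (\<forall>i. bounded (C i) \<and> diameter (C i) \<le> \<delta>)}.
        \<Sum>i. if C i = {} then 0 else ennreal (unit_ball_vol (real k) * (diameter (C i) / 2) ^ k))"

definition hausdorff_outer :: "nat \<Rightarrow> 'a::metric_space set \<Rightarrow> ennreal" where
  "hausdorff_outer k A = (SUP \<delta> \<in> {0<..}. hausdorff_content k \<delta> A)"

definition hausdorff_measure :: "nat \<Rightarrow> 'a::metric_space measure" where
  "hausdorff_measure k = measure_of UNIV (sets borel) (hausdorff_outer k)"

section \<open>Convex bodies and polytopes\<close>

definition convex_bodies :: "(real^3) set set" where
  "convex_bodies = {K. K \<noteq> {} \<and> compact K \<and> convex K}"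

definition polytopes :: "(real^3) set set" where
  "polytopes = {P. P \<noteq> {} \<and> polytope P}"

definition hausdorff_dist :: "'a::metric_space set \<Rightarrow> 'a set \<Rightarrow> real" where
  "hausdorff_dist K L = max (SUP x\<in>K. infdist x L) (SUP y\<in>L. infdist y K)"

definition normal_cone :: "(real^3) set \<Rightarrow> (real^3) set \<Rightarrow> (real^3) set" where
  "normal_cone P F = {u. \<forall>x\<in>F. \<forall>y\<in>P. u \<bullet> (y - x) \<le> 0}"

definition unit_normals :: "(real^3) set \<Rightarrow> (real^3) set \<Rightarrow> (real^3) set" where
  "unit_normals P F = normal_cone P F \<inter> sphere 0 1"

definition edge_direction :: "(real^3) set \<Rightarrow> real^3" where
  "edge_direction F = (SOME v. norm v = 1 \<and> affine_parallel (affine hull F) (span {v}))"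

section \<open>Tensor-valued measures and weak continuity\<close>

definition Sigma3 :: "((real^3) \<times> (real^3)) set" where
  "Sigma3 = {(x, u). u \<in> sphere 0 1}"

definition Sigma3_borel :: "((real^3) \<times> (real^3)) measure" where
  "Sigma3_borel = restrict_space borel Sigma3"

definition signed_measure :: "'a measure \<Rightarrow> ('a set \<Rightarrow> real) \<Rightarrow> bool" where
  "signed_measure X \<mu> \<longleftrightarrow>
     (\<forall>A :: nat \<Rightarrow> 'a set. range A \<subseteq> sets X \<and> disjoint_family A \<longrightarrow>
        (\<lambda>i. \<mu> (A i)) sums \<mu> (\<Union>i. A i))"

text \<open>
  Integration of \<open>f\<close> with respect to a (finite) signed measure \<open>\<mu>\<close>, by writing \<open>\<mu>\<close> as a difference
  of finite measures. The value does not depend on the decomposition (shown below), and since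
  the Jordan decomposition is the smallest one, it can be used whenever any decomposition can.
\<close>

definition has_signed_integral ::
  "'a measure \<Rightarrow> ('a set \<Rightarrow> real) \<Rightarrow> ('a \<Rightarrow> real) \<Rightarrow> real \<Rightarrow> bool" where
  "has_signed_integral X \<mu> f I \<longleftrightarrow>
     (\<exists>M N. finite_measure M \<and> finite_measure N \<and> sets M = sets X \<and> sets N = sets X \<and>
        (\<forall>A\<in>sets X. \<mu> A = measure M A - measure N A) \<and>
        integrable M f \<and> integrable N f \<and>
        I = (LINT x|M. f x) - (LINT x|N. f x))"

lemma nn_integral_add_measures_cong:
  assumes sets: "sets N = sets M" "sets M' = sets M" "sets N' = sets M"
    and eq: "\<And>A. A \<in> sets M \<Longrightarrow> emeasure M A + emeasure N' A = emeasure M' A + emeasure N A"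
    and f: "f \<in> borel_measurable M"
  shows "(\<integral>\<^sup>+x. f x \<partial>M) + (\<integral>\<^sup>+x. f x \<partial>N') = (\<integral>\<^sup>+x. f x \<partial>M') + (\<integral>\<^sup>+x. f x \<partial>N)"
  using f
proof (induction rule: borel_measurable_induct)
  case (cong f g)
  moreover have "space N = space M" "space M' = space M" "space N' = space M"
    using sets by (auto dest: sets_eq_imp_space_eq)
  ultimately have "(\<integral>\<^sup>+x. f x \<partial>L) = (\<integral>\<^sup>+x. g x \<partial>L)" if "L \<in> {M, N, M', N'}" for L
    using that by (intro nn_integral_cong) auto
  then show ?case using cong by simp
next
  case (set A)
  then show ?case using eq sets by simp
next
  case (mult u c)
  have [measurable]: "u \<in> borel_measurable M" "u \<in> borel_measurable N"
      "u \<in> borel_measurable M'" "u \<in> borel_measurable N'"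
    using mult sets by (simp_all cong: measurable_cong_sets)
  show ?case
    using mult by (simp add: nn_integral_cmult flip: distrib_left)
next
  case (add u v)
  have [measurable]: "u \<in> borel_measurable M" "u \<in> borel_measurable N"
      "u \<in> borel_measurable M'" "u \<in> borel_measurable N'"
      "v \<in> borel_measurable M" "v \<in> borel_measurable N"
      "v \<in> borel_measurable M'" "v \<in> borel_measurable N'"
    using add sets by (simp_all cong: measurable_cong_sets)
  have "(\<integral>\<^sup>+x. v x + u x \<partial>M) + (\<integral>\<^sup>+x. v x + u x \<partial>N')
      = ((\<integral>\<^sup>+x. v x \<partial>M) + (\<integral>\<^sup>+x. v x \<partial>N')) + ((\<integral>\<^sup>+x. u x \<partial>M) + (\<integral>\<^sup>+x. u x \<partial>N'))"
    by (simp add: nn_integral_add ac_simps)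
  also have "\<dots> = ((\<integral>\<^sup>+x. v x \<partial>M') + (\<integral>\<^sup>+x. v x \<partial>N)) + ((\<integral>\<^sup>+x. u x \<partial>M') + (\<integral>\<^sup>+x. u x \<partial>N))"
    using add by simp
  also have "\<dots> = (\<integral>\<^sup>+x. v x + u x \<partial>M') + (\<integral>\<^sup>+x. v x + u x \<partial>N)"
    by (simp add: nn_integral_add ac_simps)
  finally show ?case .
next
  case (seq U)
  have meas: "U i \<in> borel_measurable M" "U i \<in> borel_measurable N"
      "U i \<in> borel_measurable M'" "U i \<in> borel_measurable N'" for i
    using seq sets by (simp_all cong: measurable_cong_sets)
  have inc: "incseq (\<lambda>i. \<integral>\<^sup>+x. U i x \<partial>L)" for L
    using \<open>incseq U\<close> by (auto simp: incseq_def le_fun_def intro!: nn_integral_mono)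
  have conv: "(\<integral>\<^sup>+x. (SUP i. U i) x \<partial>L) = (SUP i. \<integral>\<^sup>+x. U i x \<partial>L)"
    if "\<And>i. U i \<in> borel_measurable L" for L
    using nn_integral_monotone_convergence_SUP[OF \<open>incseq U\<close> that] by (simp add: image_image)
  have "(SUP i. \<integral>\<^sup>+x. U i x \<partial>M) + (SUP i. \<integral>\<^sup>+x. U i x \<partial>N')
      = (SUP i. (\<integral>\<^sup>+x. U i x \<partial>M) + (\<integral>\<^sup>+x. U i x \<partial>N'))"
    by (rule ennreal_SUP_add[symmetric]) (rule inc)+
  also have "\<dots> = (SUP i. (\<integral>\<^sup>+x. U i x \<partial>M') + (\<integral>\<^sup>+x. U i x \<partial>N))"
    using seq by simp
  also have "\<dots> = (SUP i. \<integral>\<^sup>+x. U i x \<partial>M') + (SUP i. \<integral>\<^sup>+x. U i x \<partial>N)"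
    by (rule ennreal_SUP_add) (rule inc)+
  finally show ?case using meas by (simp only: conv)
qed

lemma has_signed_integral_unique:
  assumes "has_signed_integral X \<mu> f I" "has_signed_integral X \<mu> f J"
  shows "I = J"
proof -
  obtain M N where M: "finite_measure M" "finite_measure N" "sets M = sets X" "sets N = sets X"
    "\<And>A. A \<in> sets X \<Longrightarrow> \<mu> A = measure M A - measure N A"
    "integrable M f" "integrable N f" "I = (LINT x|M. f x) - (LINT x|N. f x)"
    using assms(1) unfolding has_signed_integral_def by blast
  obtain M' N' where M': "finite_measure M'" "finite_measure N'" "sets M' = sets X" "sets N' = sets X"
    "\<And>A. A \<in> sets X \<Longrightarrow> \<mu> A = measure M' A - measure N' A"
    "integrable M' f" "integrable N' f" "J = (LINT x|M'. f x) - (LINT x|N'. f x)"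
    using assms(2) unfolding has_signed_integral_def by blast
  have eq: "emeasure M A + emeasure N' A = emeasure M' A + emeasure N A" if "A \<in> sets M" for A
  proof -
    have "measure M A + measure N' A = measure M' A + measure N A"
      using M(3) M(5)[of A] M'(5)[of A] that by simp
    then show ?thesis
      using M(1,2) M'(1,2)
      by (simp add: finite_measure.emeasure_eq_measure flip: ennreal_plus)
  qed
  have *: "(\<integral>\<^sup>+x. g x \<partial>M) + (\<integral>\<^sup>+x. g x \<partial>N') = (\<integral>\<^sup>+x. g x \<partial>M') + (\<integral>\<^sup>+x. g x \<partial>N)"
    if "g \<in> borel_measurable M" for g
    using that by (intro nn_integral_add_measures_cong) (simp_all add: M(3,4) M'(3,4) eq[unfolded M(3)])
  have fin: "(\<integral>\<^sup>+x. ennreal (g x) \<partial>L) < \<infinity>" if "integrable L f" "\<And>x. g x \<le> \<bar>f x\<bar>" for L g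
  proof -
    have "(\<integral>\<^sup>+x. ennreal (g x) \<partial>L) \<le> (\<integral>\<^sup>+x. ennreal (norm (f x)) \<partial>L)"
      using that(2) by (intro nn_integral_mono) (simp add: ennreal_leI)
    also have "\<dots> < \<infinity>" using that(1) by (simp add: integrable_iff_bounded)
    finally show ?thesis .
  qed
  have **: "enn2real (\<integral>\<^sup>+x. ennreal (g x) \<partial>M) + enn2real (\<integral>\<^sup>+x. ennreal (g x) \<partial>N')
      = enn2real (\<integral>\<^sup>+x. ennreal (g x) \<partial>M') + enn2real (\<integral>\<^sup>+x. ennreal (g x) \<partial>N)"
    if "\<And>x. g x \<le> \<bar>f x\<bar>" "g \<in> borel_measurable M" for g
    using *[of "\<lambda>x. ennreal (g x)"] that
      fin[OF M(6), of g] fin[OF M(7), of g] fin[OF M'(6), of g] fin[OF M'(7), of g]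
    by (simp flip: enn2real_plus)
  have "f \<in> borel_measurable M" using M(6) by simp
  then show ?thesis
    using **[of f, OF abs_ge_self] **[of "\<lambda>x. - f x", OF abs_ge_minus_self]
    by (simp add: M(6-8) M'(6-8) real_lebesgue_integral_def)
qed

definition tensor_measure :: "nat \<Rightarrow> (((real^3) \<times> (real^3)) set \<Rightarrow> tensor) \<Rightarrow> bool" where
  "tensor_measure p \<mu> \<longleftrightarrow>
     (\<forall>\<eta>\<in>sets Sigma3_borel. \<mu> \<eta> \<in> sym_tensors p) \<and>
     (\<forall>ys. signed_measure Sigma3_borel (\<lambda>\<eta>. \<mu> \<eta> ys))"

text \<open>The tensors of a fixed rank form a finite-dimensional space, so that integrals and limits
  can be taken pointwise, for each list \<open>ys\<close> of arguments.\<close>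

definition weakly_continuous ::
  "((real^3) set \<Rightarrow> ((real^3) \<times> (real^3)) set \<Rightarrow> tensor) \<Rightarrow> bool" where
  "weakly_continuous \<Gamma> \<longleftrightarrow>
     (\<forall>K L. (\<forall>i::nat. K i \<in> convex_bodies) \<and> L \<in> convex_bodies \<and>
        (\<lambda>i. hausdorff_dist (K i) L) \<longlonglongrightarrow> 0 \<longrightarrow>
        (\<forall>f ys. continuous_on Sigma3 f \<longrightarrow>
           (\<exists>I J. (\<forall>i. has_signed_integral Sigma3_borel (\<lambda>\<eta>. \<Gamma> (K i) \<eta> ys) f (I i)) \<and>
              has_signed_integral Sigma3_borel (\<lambda>\<eta>. \<Gamma> L \<eta> ys) f J \<and> I \<longlonglongrightarrow> J)))"

section \<open>The local tensor functional and its extension\<close>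

definition phi_polytope ::
  "nat \<Rightarrow> nat \<Rightarrow> (real^3) set \<Rightarrow> ((real^3) \<times> (real^3)) set \<Rightarrow> tensor" where
  "phi_polytope r s P \<eta> = (\<lambda>ys. \<Sum>F | F edge_of P.
     (let v = edge_direction F in
      vec_tensor v \<odot> (\<lambda>zs.
        LINT x:F|hausdorff_measure 1. LINT u:unit_normals P F|hausdorff_measure 1.
          indicator \<eta> (x, u) *
          (sym_power x r \<odot> vec_tensor (cross3 v u) \<odot> sym_power u s) zs)) ys)"

definition weakly_continuous_extension ::
  "nat \<Rightarrow> nat \<Rightarrow> ((real^3) set \<Rightarrow> ((real^3) \<times> (real^3)) set \<Rightarrow> tensor) \<Rightarrow> bool" where
  "weakly_continuous_extension r s \<Gamma> \<longleftrightarrow>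
     (\<forall>K\<in>convex_bodies. tensor_measure (r + s + 2) (\<Gamma> K)) \<and>
     weakly_continuous \<Gamma> \<and>
     (\<forall>P\<in>polytopes. \<forall>\<eta>\<in>sets Sigma3_borel. \<Gamma> P \<eta> = phi_polytope r s P \<eta>)"

end

theory Submission
  imports Defs
begin

text \<open>
  The tensor \<open>T K\<close> is symmetric and multilinear, so by polarization it suffices to evaluate it at
  \<open>(y, \<dots>, y)\<close> for a vector \<open>y\<close> (\<open>sym_tensor_eq_0_if_diagonal_0\<close>). By weak continuity, with the
  constant \<open>1\<close> as test function, it suffices to consider a sequence of polytopes converging to \<open>K\<close>,
  and these can be chosen three-dimensional (\<open>approximating_polytope\<close>).

  For an edge \<open>F = [a, b]\<close> of a three-dimensional polytope with direction \<open>v\<close>, both integrals in the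
  contribution of \<open>F\<close> have derivatives as integrands: along \<open>F\<close> the function \<open>(v \<bullet> y) (x \<bullet> y)\<^sup>r\<close> is
  the derivative of \<open>(x \<bullet> y)\<^bsup>r+1\<^esup> / (r + 1)\<close>, and along the circular arc of normal vectors, which leads
  from the normal \<open>n\<^sub>1\<close> of one facet at \<open>F\<close> to the normal \<open>n\<^sub>2\<close> of the other, the velocity at \<open>u\<close>
  is the vector product of \<open>v\<close> and \<open>u\<close>. So the contribution of \<open>F\<close> is, up to a constant that depends
  only on \<open>r\<close> and \<open>s\<close>,
  \<open>((b \<bullet> y)\<^bsup>r+1\<^esup> - (a \<bullet> y)\<^bsup>r+1\<^esup>) ((n\<^sub>2 \<bullet> y)\<^bsup>s+1\<^esup> - (n\<^sub>1 \<bullet> y)\<^bsup>s+1\<^esup>)\<close>.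

  Expanding the product gives one term \<open>\<plusminus> (c \<bullet> y)\<^bsup>r+1\<^esup> (n \<bullet> y)\<^bsup>s+1\<^esup>\<close> for each flag of a vertex \<open>c\<close>
  of \<open>F\<close> and a facet with normal \<open>n\<close> at \<open>F\<close> (\<open>edge_integral_eq_flag_sum\<close>). The term depends on the
  edge only through its sign. Given a vertex \<open>c\<close> of a facet, exactly two edges of this facet contain
  \<open>c\<close>; in the orientation of the boundary of the facet one of them runs towards \<open>c\<close> and the other one
  away from \<open>c\<close>, so their signs are opposite (\<open>flag_signs_cancel\<close>) and the sum over all flags vanishes.

  All integrals are taken with respect to Hausdorff measure. They become integrals of the parameter
  because Hausdorff measure assigns its length to each injective curve of unit speed
  (\<open>integral_hausdorff_curve\<close>).
\<close>

section \<open>One-dimensional Hausdorff measure of curves\<close>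

text \<open>
  Cut the parameter interval into so many equal pieces that their images are covering sets of
  diameter at most \<open>\<delta>\<close>: the diameters then add up to at most \<open>t - s\<close>, whatever \<open>\<delta>\<close> is.
\<close>

lemma hausdorff_outer_lipschitz_curve_le:
  fixes \<gamma> :: "real \<Rightarrow> 'a::metric_space"
  assumes st: "s \<le> t" and lip: "\<And>x y. dist (\<gamma> x) (\<gamma> y) \<le> \<bar>x - y\<bar>"
  shows "hausdorff_outer 1 (\<gamma> ` {s..t}) \<le> ennreal (t - s)"
  unfolding hausdorff_outer_def
proof (rule SUP_least)
  fix \<delta> :: real assume "\<delta> \<in> {0<..}"
  then have \<delta>: "\<delta> > 0" by simp
  obtain N :: nat where "max 1 ((t - s) / \<delta>) < real N"
    using reals_Archimedean2 by blast
  then have N: "(t - s) / \<delta> < real N" "N > 0" by auto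
  define h where "h = (t - s) / N"
  have h: "0 \<le> h" "h \<le> \<delta>" "real N * h = t - s"
    using N st \<delta> by (auto simp: h_def field_simps)
  define C where "C i = (if i < N then \<gamma> ` {s + i * h..s + (real i + 1) * h} else {})" for i
  have dist_C: "dist x y \<le> h" if xy: "x \<in> C i" "y \<in> C i" for x y i
  proof -
    obtain p q where pq: "x = \<gamma> p" "y = \<gamma> q" "p \<in> {s + i * h..s + (real i + 1) * h}"
        "q \<in> {s + i * h..s + (real i + 1) * h}"
      using xy by (auto simp: C_def split: if_splits)
    have "\<bar>p - q\<bar> \<le> h" using pq(3,4) by (auto simp: algebra_simps)
    then show ?thesis using lip[of p q] pq by simp
  qed
  have bounded_C: "bounded (C i)" for i
    using dist_C unfolding bounded_def by metis
  have diam_C: "diameter (C i) \<le> h" for i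
    using h(1) dist_C by (auto simp: diameter_def intro!: cSUP_least)
  have "\<gamma> ` {s..t} \<subseteq> (\<Union>i. C i)"
  proof safe
    fix x assume x: "x \<in> {s..t}"
    show "\<gamma> x \<in> (\<Union>i. C i)"
    \<comment> \<open>The right end point lies in the last piece, but its quotient \<open>(x - s) / h\<close> is \<open>N\<close>,
      one beyond the last index.\<close>
    proof (cases "x = t")
      case True
      have "s + real (N - 1) * h \<le> t" "t \<le> s + (real (N - 1) + 1) * h"
        using h N by (auto simp: of_nat_diff algebra_simps)
      then have "\<gamma> x \<in> C (N - 1)"
        unfolding C_def using True N by auto
      then show ?thesis by blast
    next
      case False
      then have "h > 0" using x N by (auto simp: h_def)
      define i where "i = nat \<lfloor>(x - s) / h\<rfloor>"
      have i: "real i \<le> (x - s) / h" "(x - s) / h < real i + 1"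
        using x \<open>h > 0\<close> by (auto simp: i_def)
      have "real i * h \<le> x - s" using i(1) \<open>h > 0\<close> by (simp add: field_simps)
      also have "\<dots> < real N * h" using x False h(3) by auto
      finally have "real i * h < real N * h" .
      then have "i < N" using \<open>h > 0\<close> by simp
      moreover have "x \<in> {s + i * h..s + (real i + 1) * h}"
        using i \<open>h > 0\<close> by (auto simp: field_simps)
      ultimately have "\<gamma> x \<in> C i" unfolding C_def by auto
      then show ?thesis by blast
    qed
  qed
  then have "hausdorff_content 1 \<delta> (\<gamma> ` {s..t})
      \<le> (\<Sum>i. if C i = {} then 0 else ennreal (unit_ball_vol (real 1) * (diameter (C i) / 2) ^ 1))"
    unfolding hausdorff_content_def using bounded_C order_trans[OF diam_C h(2)]
    by (intro INF_lower) auto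
  also have "\<dots> = (\<Sum>i<N. if C i = {} then 0 else ennreal (unit_ball_vol (real 1) * (diameter (C i) / 2) ^ 1))"
    by (rule suminf_finite) (auto simp: C_def)
  also have "\<dots> \<le> (\<Sum>i<N. ennreal h)"
    using diam_C by (intro sum_mono) (auto simp: unit_ball_vol_1 intro!: ennreal_leI)
  also have "\<dots> = ennreal (t - s)"
    using h by (simp add: ennreal_of_nat_eq_real_of_nat flip: ennreal_mult)
  finally show "hausdorff_content 1 \<delta> (\<gamma> ` {s..t}) \<le> ennreal (t - s)" .
qed

text \<open>
  The distance from \<open>x\<close> does not increase distances and maps \<open>A\<close> onto a connected set that
  contains \<open>0\<close> and \<open>dist x y\<close>. Each cover of \<open>A\<close> thus induces a cover of the interval between
  these numbers by intervals no longer than the diameters of the covering sets, and Lebesgue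
  measure is countably subadditive.
\<close>

lemma hausdorff_outer_connected_ge:
  fixes A :: "'a::metric_space set"
  assumes A: "connected A" "x \<in> A" "y \<in> A"
  shows "ennreal (dist x y) \<le> hausdorff_outer 1 A"
proof -
  have "ennreal (dist x y) \<le> hausdorff_content 1 1 A"
    unfolding hausdorff_content_def
  proof (rule INF_greatest)
    fix C :: "nat \<Rightarrow> 'a set"
    assume "C \<in> {C. A \<subseteq> (\<Union>i. C i) \<and> (\<forall>i. bounded (C i) \<and> diameter (C i) \<le> 1)}"
    then have cover: "A \<subseteq> (\<Union>i. C i)" and C: "\<forall>i. bounded (C i) \<and> diameter (C i) \<le> 1" by auto
    define J where "J i = (if C i = {} then {} else {Inf (dist x ` C i)..Sup (dist x ` C i)})" for i
    have bdd: "bdd_above (dist x ` C i)" "bdd_below (dist x ` C i)" for i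
    proof -
      obtain B where "\<forall>z\<in>C i. dist x z \<le> B"
        using C bounded_any_center[of "C i" x] by blast
      then show "bdd_above (dist x ` C i)" by (auto simp: bdd_above_def)
      show "bdd_below (dist x ` C i)" by (auto simp: bdd_below_def intro!: exI[of _ 0])
    qed
    have J_le: "emeasure lborel (J i) \<le> (if C i = {} then 0 else ennreal (diameter (C i)))" for i
    proof (cases "C i = {}")
      case False
      have "dist x z - diameter (C i) \<le> dist x w" if "z \<in> C i" "w \<in> C i" for z w
        using diameter_bounded_bound[of "C i" w z] C that dist_triangle[of x z w] by simp
      then have "dist x z - diameter (C i) \<le> Inf (dist x ` C i)" if "z \<in> C i" for z
        using False that by (intro cInf_greatest) auto
      then have "Sup (dist x ` C i) \<le> Inf (dist x ` C i) + diameter (C i)"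
        using False by (intro cSup_least) (auto simp: algebra_simps)
      moreover have "Inf (dist x ` C i) \<le> Sup (dist x ` C i)"
        using False bdd by (intro cInf_le_cSup) auto
      ultimately show ?thesis using False by (auto simp: J_def intro!: ennreal_leI)
    qed (simp add: J_def)
    have "connected (dist x ` A)"
      using A by (intro connected_continuous_image continuous_intros)
    then have "{0..dist x y} \<subseteq> dist x ` A"
      using A by (intro connected_contains_Icc) (auto simp: image_iff intro!: bexI[of _ x] bexI[of _ y])
    also have "\<dots> \<subseteq> (\<Union>i. J i)"
    proof safe
      fix z assume "z \<in> A"
      then obtain i where "z \<in> C i" using cover by blast
      then have "dist x z \<in> J i"
        using bdd by (auto simp: J_def intro!: cInf_lower cSup_upper)
      then show "dist x z \<in> (\<Union>i. J i)" by blast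
    qed
    finally have "emeasure lborel {0..dist x y} \<le> emeasure lborel (\<Union>i. J i)"
      by (intro emeasure_mono) (auto simp: J_def)
    also have "\<dots> \<le> (\<Sum>i. emeasure lborel (J i))"
      by (intro emeasure_subadditive_countably) (auto simp: J_def)
    also have "\<dots> \<le> (\<Sum>i. if C i = {} then 0 else ennreal (diameter (C i)))"
      by (intro suminf_le J_le) auto
    finally show "ennreal (dist x y)
        \<le> (\<Sum>i. if C i = {} then 0 else ennreal (unit_ball_vol (real 1) * (diameter (C i) / 2) ^ 1))"
      by (simp add: unit_ball_vol_1 cong: if_cong)
  qed
  also have "\<dots> \<le> hausdorff_outer 1 A"
    unfolding hausdorff_outer_def by (intro SUP_upper) auto
  finally show ?thesis .
qed

lemma
  shows space_hausdorff_measure [simp]: "space (hausdorff_measure k) = UNIV"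
    and sets_hausdorff_measure [simp, measurable_cong]: "sets (hausdorff_measure k) = sets borel"
  using sets.sigma_sets_eq[of borel]
  by (auto simp: hausdorff_measure_def space_measure_of_conv sets_measure_of_conv)

lemma emeasure_hausdorff_measure:
  assumes "measure_space UNIV (sets borel) (hausdorff_outer k :: 'a::metric_space set \<Rightarrow> ennreal)"
    and "A \<in> sets (borel :: 'a measure)"
  shows "emeasure (hausdorff_measure k) A = hausdorff_outer k A"
  unfolding hausdorff_measure_def
  by (rule emeasure_measure_of_sigma) (use assms in \<open>auto simp: measure_space_def\<close>)

lemma unit_speed_lipschitz:
  fixes \<gamma> :: "real \<Rightarrow> 'a::real_normed_vector"
  assumes "\<And>t. (\<gamma> has_vector_derivative \<gamma>' t) (at t)" "\<And>t. norm (\<gamma>' t) = 1"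
  shows "dist (\<gamma> x) (\<gamma> y) \<le> \<bar>x - y\<bar>"
proof -
  have "norm (\<gamma> x - \<gamma> y) \<le> 1 * norm (x - y)"
  proof (rule differentiable_bound)
    show "(\<gamma> has_derivative (\<lambda>h. h *\<^sub>R \<gamma>' t)) (at t within UNIV)" for t
      using assms(1) by (simp add: has_vector_derivative_def)
    show "onorm (\<lambda>h. h *\<^sub>R \<gamma>' t) \<le> 1" for t
      by (rule onorm_le) (simp add: assms(2))
  qed auto
  then show ?thesis by (simp add: dist_norm)
qed

text \<open>
  The measure \<open>\<phi> t\<close> of the part of the curve up to the parameter \<open>t\<close> grows between \<open>s\<close> and \<open>t\<close>
  by at least the chord and at most \<open>t - s\<close>: these are the estimates
  \<open>hausdorff_outer_connected_ge\<close> and \<open>hausdorff_outer_lipschitz_curve_le\<close>. At unit speed the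
  ratio of these bounds tends to \<open>1\<close> as \<open>t\<close> approaches \<open>s\<close>. Hence \<open>\<phi>\<close> has derivative \<open>1\<close>.
\<close>

lemma hausdorff_measure_curve:
  fixes \<gamma> :: "real \<Rightarrow> 'a::euclidean_space"
  assumes ms: "measure_space UNIV (sets borel) (hausdorff_outer 1 :: 'a set \<Rightarrow> ennreal)"
    and deriv: "\<And>t. (\<gamma> has_vector_derivative \<gamma>' t) (at t)" and unit: "\<And>t. norm (\<gamma>' t) = 1"
    and inj: "inj_on \<gamma> {a..b}" and ab: "a \<le> b"
  shows "emeasure (hausdorff_measure 1) (\<gamma> ` {a..b}) = ennreal (b - a)"
    and "emeasure (hausdorff_measure 1) (\<gamma> ` {a<..b}) = ennreal (b - a)"
proof -
  let ?H = "hausdorff_measure 1 :: 'a measure"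
  have cont: "continuous_on S \<gamma>" for S
    using deriv has_vector_derivative_continuous by (blast intro: continuous_at_imp_continuous_on)
  have borel_Icc [measurable]: "\<gamma> ` {s..t} \<in> sets borel" for s t
    by (intro borel_compact compact_continuous_image cont) auto
  have Icc_le: "emeasure ?H (\<gamma> ` {s..t}) \<le> ennreal (t - s)" if "s \<le> t" for s t
    using hausdorff_outer_lipschitz_curve_le[OF that unit_speed_lipschitz[OF deriv unit]]
    by (subst emeasure_hausdorff_measure[OF ms]) auto
  have Icc_ge: "ennreal (dist (\<gamma> s) (\<gamma> t)) \<le> emeasure ?H (\<gamma> ` {s..t})" if "s \<le> t" for s t
    by (subst emeasure_hausdorff_measure[OF ms], simp, intro hausdorff_outer_connected_ge
        connected_continuous_image cont) (use that in auto)
  define \<phi> where "\<phi> t = measure ?H (\<gamma> ` {a..t})" for t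
  have fin: "emeasure ?H (\<gamma> ` {s..t}) = ennreal (measure ?H (\<gamma> ` {s..t}))" for s t
  proof (cases "s \<le> t")
    case True
    have "emeasure ?H (\<gamma> ` {s..t}) < \<infinity>"
      using Icc_le[OF True] by (simp add: le_less_trans[OF _ ennreal_less_top])
    then show ?thesis by (intro emeasure_eq_ennreal_measure) auto
  qed auto
  have point: "emeasure ?H {\<gamma> s} = 0" for s
    using Icc_le[of s s] by simp
  have diff: "dist (\<gamma> s) (\<gamma> t) \<le> \<phi> t - \<phi> s" "\<phi> t - \<phi> s \<le> t - s"
    if st: "a \<le> s" "s \<le> t" "t \<le> b" for s t
  proof -
    have un: "\<gamma> ` {a..t} = \<gamma> ` {a..s} \<union> \<gamma> ` {s..t}"
      using st by (simp add: image_Un[symmetric] ivl_disj_un_two_touch)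
    have "\<gamma> ` {a..s} \<inter> \<gamma> ` {s..t} = \<gamma> ` ({a..s} \<inter> {s..t})"
      using st by (intro inj_on_image_Int[symmetric, OF inj]) auto
    also have "{a..s} \<inter> {s..t} = {s}" using st by auto
    finally have "emeasure ?H (\<gamma> ` {a..s} \<inter> \<gamma> ` {s..t}) = 0" using point by simp
    then have "emeasure ?H (\<gamma> ` {a..t}) = emeasure ?H (\<gamma> ` {a..s}) + emeasure ?H (\<gamma> ` {s..t})"
      unfolding un using emeasure_Un_Int[of "\<gamma> ` {a..s}" ?H "\<gamma> ` {s..t}"] by simp
    then have eq: "\<phi> t = \<phi> s + measure ?H (\<gamma> ` {s..t})"
      unfolding fin \<phi>_def by (simp flip: ennreal_plus)
    show "dist (\<gamma> s) (\<gamma> t) \<le> \<phi> t - \<phi> s" "\<phi> t - \<phi> s \<le> t - s"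
      using Icc_ge[of s t] Icc_le[of s t] st unfolding eq fin by simp_all
  qed
  have "(\<phi> has_vector_derivative 1) (at t within {a..b})" if t: "t \<in> {a..b}" for t
  proof -
    \<comment> \<open>The increment of \<open>\<phi>\<close> lies between chord and parameter difference, so the linear
      approximation of \<open>\<phi>\<close> is at least as good as that of the curve.\<close>
    have *: "norm (\<phi> x - \<phi> t - (x - t)) \<le> norm (\<gamma> x - \<gamma> t - (x - t) *\<^sub>R \<gamma>' t)" if x: "x \<in> {a..b}" for x
    proof -
      have "\<bar>x - t\<bar> = norm ((x - t) *\<^sub>R \<gamma>' t)" using unit by simp
      also have "\<dots> \<le> norm (\<gamma> x - \<gamma> t) + norm (\<gamma> x - \<gamma> t - (x - t) *\<^sub>R \<gamma>' t)"
        by (metis norm_minus_commute norm_triangle_sub)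
      finally show ?thesis
        using diff[of x t] diff[of t x] x t by (cases "x \<le> t") (auto simp: dist_norm norm_minus_commute)
    qed
    have "((\<lambda>x. norm (\<gamma> x - \<gamma> t - (x - t) *\<^sub>R \<gamma>' t) / norm (x - t)) \<longlongrightarrow> 0) (at t within {a..b})"
      using has_vector_derivative_at_within[OF deriv, of t "{a..b}"]
      by (simp add: has_vector_derivative_def has_derivative_iff_norm)
    then have "((\<lambda>x. norm (\<phi> x - \<phi> t - (x - t)) / norm (x - t)) \<longlongrightarrow> 0) (at t within {a..b})"
      by (rule tendsto_0_le[where K = 1])
         (use * in \<open>auto simp: eventually_at_filter divide_right_mono\<close>)
    then show ?thesis
      by (simp add: has_vector_derivative_def has_derivative_iff_norm bounded_linear_ident)
  qed
  then have "((\<lambda>_. 1 :: real) has_integral \<phi> b - \<phi> a) {a..b}"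
    by (rule fundamental_theorem_of_calculus[OF ab])
  then have "\<phi> b - \<phi> a = measure lborel {a..b} *\<^sub>R 1"
    by (rule has_integral_unique) (rule has_integral_const_real)
  then have "\<phi> b - \<phi> a = b - a" using ab by simp
  moreover have "\<phi> a = 0" using point[of a] by (simp add: \<phi>_def measure_def)
  ultimately show Icc: "emeasure ?H (\<gamma> ` {a..b}) = ennreal (b - a)"
    unfolding fin by (simp add: \<phi>_def)
  have "{a<..b} = {a..b} - {a}" by auto
  then have "\<gamma> ` {a<..b} = \<gamma> ` {a..b} - {\<gamma> a}"
    using inj_on_image_set_diff[OF inj, of "{a..b}" "{a}"] ab by simp
  moreover have "emeasure ?H (\<gamma> ` {a..b} - {\<gamma> a}) = emeasure ?H (\<gamma> ` {a..b})"
    by (intro emeasure_Diff_null_set null_setsI point) auto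
  ultimately show "emeasure ?H (\<gamma> ` {a<..b}) = ennreal (b - a)" using Icc by simp
qed

text \<open>
  Forming a measure from a set function with \<open>measure_of\<close> returns the zero measure if the set
  function is not countably additive. The constant records which case holds for the
  one-dimensional Hausdorff measure, so that integrals over curves are \<open>length_factor\<close> times the
  integrals over the parameter in both cases. What matters below is that one and the same factor
  serves segments and circular arcs.
\<close>

definition length_factor :: real where
  "length_factor =
     (if measure_space UNIV (sets borel) (hausdorff_outer 1 :: (real^3) set \<Rightarrow> ennreal) then 1 else 0)"

text \<open>
  The inverse of the parametrization pushes the Hausdorff measure on the curve forward to
  Lebesgue measure on the parameter interval, because the two agree on half-lines.
\<close>

lemma integral_hausdorff_curve:
  fixes \<gamma> :: "real \<Rightarrow> real^3" and f :: "real^3 \<Rightarrow> real"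
  assumes deriv: "\<And>t. (\<gamma> has_vector_derivative \<gamma>' t) (at t)" and unit: "\<And>t. norm (\<gamma>' t) = 1"
    and inj: "inj_on \<gamma> {0..L}" and L: "0 \<le> L" and f: "continuous_on UNIV f"
  shows "(LINT x:\<gamma> ` {0..L}|hausdorff_measure 1. f x) = length_factor * (LBINT t:{0..L}. f (\<gamma> t))"
proof (cases "measure_space UNIV (sets borel) (hausdorff_outer 1 :: (real^3) set \<Rightarrow> ennreal)")
  case False
  then have "emeasure (hausdorff_measure 1) (A :: (real^3) set) = 0" for A
    unfolding hausdorff_measure_def emeasure_measure_of_conv
    using sets.sigma_sets_eq[of "borel :: (real^3) measure"] by simp
  then have "AE x in (hausdorff_measure 1 :: (real^3) measure). False"
    by (intro AE_I[of _ _ UNIV]) auto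
  then have "(LINT x:A|hausdorff_measure 1. g x) = 0" for A and g :: "real^3 \<Rightarrow> real"
    unfolding set_lebesgue_integral_def
    by (intro integral_eq_zero_AE) (rule AE_mp, auto)
  then show ?thesis using False by (simp add: length_factor_def)
next
  case ms: True
  let ?H = "hausdorff_measure 1 :: (real^3) measure"
  let ?C = "\<gamma> ` {0..L}"
  have cont: "continuous_on S \<gamma>" for S
    using deriv has_vector_derivative_continuous by (blast intro: continuous_at_imp_continuous_on)
  have C [measurable]: "?C \<in> sets borel"
    by (intro borel_compact compact_continuous_image cont) auto
  define \<theta> where "\<theta> = the_inv_into {0..L} \<gamma>"
  have \<theta>: "\<theta> (\<gamma> t) = t" if "t \<in> {0..L}" for t
    using that inj by (simp add: \<theta>_def the_inv_into_f_f)
  have "continuous_on ?C \<theta>"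
    by (rule continuous_on_inv[OF cont]) (auto simp: \<theta>)
  then have \<theta>_meas [measurable]: "\<theta> \<in> borel_measurable (restrict_space ?H ?C)"
    using borel_measurable_continuous_on_restrict
      measurable_cong_sets[OF sets_restrict_space_cong[OF sets_hausdorff_measure] refl] by blast
  have f_meas [measurable]: "(\<lambda>t. f (\<gamma> t)) \<in> borel_measurable borel"
    using continuous_on_compose2[OF f cont] by (intro borel_measurable_continuous_onI) auto
  \<comment> \<open>On a half-line both sides are the length of its intersection with the parameter interval.\<close>
  have "distr (restrict_space ?H ?C) borel \<theta> = density lborel (indicator {0..L})"
  proof (rule measure_eqI_lessThan)
    fix x :: real
    have "emeasure (distr (restrict_space ?H ?C) borel \<theta>) {x<..}
        = emeasure (restrict_space ?H ?C) (\<theta> -` {x<..} \<inter> ?C)"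
      by (subst emeasure_distr) (auto simp: space_restrict_space)
    also have "\<theta> -` {x<..} \<inter> ?C = \<gamma> ` ({0..L} \<inter> {x<..})"
      by (auto simp: \<theta>)
    also have "emeasure (restrict_space ?H ?C) \<dots> = emeasure ?H \<dots>"
      by (intro emeasure_restrict_space) auto
    also have "\<dots> = (if x < 0 then ennreal L else if x \<le> L then ennreal (L - x) else 0)"
    proof -
      consider "x < 0" | "0 \<le> x" "x \<le> L" | "x > L" by linarith
      then show ?thesis
      proof cases
        case 1
        then have "{0..L} \<inter> {x<..} = {0..L}" by auto
        then show ?thesis
          using hausdorff_measure_curve(1)[OF ms deriv unit inj L] 1 by simp
      next
        case 2
        have "{0..L} \<inter> {x<..} = {x<..L}" using 2 by auto
        moreover have "inj_on \<gamma> {x..L}" using inj 2 by (auto intro: inj_on_subset)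
        ultimately show ?thesis
          using hausdorff_measure_curve(2)[OF ms deriv unit, of x L] 2 by simp
      next
        case 3
        then have "{0..L} \<inter> {x<..} = {}" by auto
        then show ?thesis using 3 L by simp
      qed
    qed
    finally have 1: "emeasure (distr (restrict_space ?H ?C) borel \<theta>) {x<..}
        = (if x < 0 then ennreal L else if x \<le> L then ennreal (L - x) else 0)" .
    have "emeasure (density lborel (indicator {0..L})) {x<..} = emeasure lborel ({0..L} \<inter> {x<..})"
      by (subst emeasure_density) (auto simp: nn_integral_cmult_indicator indicator_inter_arith[symmetric]
          nn_integral_indicator)
    also have "{0..L} \<inter> {x<..} = (if x < 0 then {0..L} else if x \<le> L then {x<..L} else {})"
      by auto
    finally show "emeasure (distr (restrict_space ?H ?C) borel \<theta>) {x<..}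
        = emeasure (density lborel (indicator {0..L})) {x<..}"
      using L unfolding 1 by auto
    show "emeasure (distr (restrict_space ?H ?C) borel \<theta>) {x<..} < \<infinity>"
      unfolding 1 by auto
  qed auto
  note distr_eq = this
  have "(LINT x:?C|?H. f x) = (\<integral>x. f x \<partial>restrict_space ?H ?C)"
    unfolding set_lebesgue_integral_def by (subst integral_restrict_space) auto
  also have "\<dots> = (\<integral>x. f (\<gamma> (\<theta> x)) \<partial>restrict_space ?H ?C)"
    by (intro Bochner_Integration.integral_cong) (auto simp: space_restrict_space \<theta>)
  also have "\<dots> = (\<integral>t. f (\<gamma> t) \<partial>distr (restrict_space ?H ?C) borel \<theta>)"
    by (subst integral_distr) auto
  also have "\<dots> = (LBINT t:{0..L}. f (\<gamma> t))"
    unfolding distr_eq set_lebesgue_integral_def ennreal_indicator[symmetric]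
    by (subst integral_density) auto
  finally show ?thesis using ms by (simp add: length_factor_def)
qed

section \<open>Symmetric tensors on the diagonal\<close>

lemma sym_tensor_cong_mset:
  assumes "T \<in> sym_tensors p" "length ys = p" "mset xs = mset ys"
  shows "T xs = T ys"
proof -
  obtain \<sigma> where \<sigma>: "\<sigma> permutes {..<length ys}" "permute_list \<sigma> ys = xs"
    using assms(3) by (rule mset_eq_permutation)
  then have "T (permute_list \<sigma> ys) = T ys"
    using assms(1,2) unfolding sym_tensors_def by auto
  then show ?thesis using \<sigma> by simp
qed

lemma sym_tensor_middle_linear:
  assumes "T \<in> sym_tensors p" "length zs + length ws + 1 = p"
  shows "T (zs @ (y + t *\<^sub>R w) # ws) = T (zs @ y # ws) + t * T (zs @ w # ws)"
proof -
  have "\<forall>ys i. length ys = p \<and> i < p \<longrightarrow> linear (\<lambda>x. T (ys[i := x]))"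
    using assms(1) unfolding sym_tensors_def by blast
  from this[rule_format, of "zs @ y # ws" "length zs"]
  have "linear (\<lambda>x. T ((zs @ y # ws)[length zs := x]))"
    using assms(2) by simp
  then have "linear (\<lambda>x. T (zs @ x # ws))" by simp
  from linear_add[OF this, of y "t *\<^sub>R w"] linear_scale[OF this, of t w] show ?thesis by simp
qed

text \<open>
  Moving \<open>m\<close> equal arguments simultaneously in the direction \<open>w\<close> changes the tensor, to first
  order, by one term for each argument, in which that argument is replaced by \<open>w\<close>; by symmetry
  the \<open>m\<close> terms are equal.
\<close>

lemma sym_tensor_diagonal_derivative:
  assumes T: "T \<in> sym_tensors p" and "length zs + m = p"
  shows "((\<lambda>t. T (zs @ replicate m (y + t *\<^sub>R w))) has_real_derivative
            real m * T (zs @ w # replicate (m - 1) y)) (at 0)"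
  using assms(2)
proof (induction m arbitrary: zs)
  case 0
  then show ?case by simp
next
  case (Suc m)
  let ?R = "\<lambda>t. replicate m (y + t *\<^sub>R w)"
  have eq: "T (zs @ replicate (Suc m) (y + t *\<^sub>R w)) = T ((zs @ [y]) @ ?R t) + t * T ((zs @ [w]) @ ?R t)" for t
    using sym_tensor_middle_linear[OF T, of zs "?R t" y t w] Suc.prems by simp
  \<comment> \<open>For \<open>m = 0\<close> the truncated subtraction makes the arguments lists of different
    lengths, but then both sides vanish because of the factor.\<close>
  have swap: "real m * T ((zs @ [y]) @ w # replicate (m - 1) y) = real m * T (zs @ w # replicate m y)"
  proof (cases m)
    case (Suc k)
    show ?thesis
      by (intro arg_cong2[where f = "(*)"] refl sym_tensor_cong_mset[OF T])
        (use Suc Suc.prems in auto)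
  qed simp
  have "((\<lambda>t. T ((zs @ [y]) @ ?R t)) has_real_derivative real m * T (zs @ w # replicate m y)) (at 0)"
    using Suc.IH[of "zs @ [y]"] Suc.prems unfolding swap by simp
  moreover have "((\<lambda>t. T ((zs @ [w]) @ ?R t)) has_real_derivative
      real m * T ((zs @ [w]) @ w # replicate (m - 1) y)) (at 0)"
    using Suc.IH[of "zs @ [w]"] Suc.prems by simp
  ultimately show ?case
    unfolding eq using DERIV_add[OF _ DERIV_mult[OF DERIV_ident]] by (fastforce simp: algebra_simps)
qed

text \<open>
  Polarization. If the tensor vanishes whenever the last \<open>Suc m\<close> arguments are equal, then so does
  its derivative in these arguments; thus one more argument can be made arbitrary.
\<close>

lemma sym_tensor_eq_0_if_diagonal_0:
  assumes T: "T \<in> sym_tensors p" and diag: "\<And>y. T (replicate p y) = 0"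
  shows "T ys = 0"
proof (cases "length ys = p")
  case False
  then show ?thesis using T by (simp add: sym_tensors_def)
next
  case True
  have "T (zs @ replicate m y) = 0" if "length zs + m = p" for zs m y
    using that
  proof (induction zs arbitrary: m y rule: rev_induct)
    case Nil
    then show ?case using diag by simp
  next
    case (snoc w zs)
    have "((\<lambda>t. T (zs @ replicate (Suc m) (y + t *\<^sub>R w))) has_real_derivative
            real (Suc m) * T (zs @ w # replicate (Suc m - 1) y)) (at 0)"
      using snoc.prems by (intro sym_tensor_diagonal_derivative[OF T]) simp
    moreover have "(\<lambda>t. T (zs @ replicate (Suc m) (y + t *\<^sub>R w))) = (\<lambda>t. 0)"
      using snoc.IH[of "Suc m"] snoc.prems by (intro ext) simp
    ultimately have "real (Suc m) * T (zs @ w # replicate (Suc m - 1) y) = 0"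
      using DERIV_unique[OF _ DERIV_const] by metis
    then show ?case by simp
  qed
  from this[of ys 0] True show ?thesis by simp
qed

lemma sym_prod_rank:
  assumes "\<And>zs. length zs \<noteq> p \<Longrightarrow> S zs = 0" "\<And>zs. length zs \<noteq> q \<Longrightarrow> T zs = 0"
    and "length ys \<noteq> p + q"
  shows "(S \<odot> T) ys = 0"
proof -
  have *: "S (take k zs) * T (drop k zs) = 0" if "length zs = length ys" for k zs
    using assms that by (cases "length (take k zs) = p") auto
  show ?thesis by (auto simp: sym_prod_def intro!: sum.neutral *)
qed

lemma sym_power_rank: "length ys \<noteq> r \<Longrightarrow> sym_power x r ys = 0"
proof (induction r arbitrary: ys)
  case (Suc r)
  then show ?case
    by (auto intro!: sym_prod_rank[of 1 _ r] simp: vec_tensor_def)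
qed (simp add: one_tensor_def)

text \<open>
  All permutations fix a constant list, so the symmetrization averages \<open>n!\<close> equal terms, and the
  rank of the first factor selects the only way to split the list.
\<close>

lemma sym_prod_diagonal:
  assumes S: "\<And>zs. length zs \<noteq> p \<Longrightarrow> S zs = 0"
  shows "(S \<odot> T) (replicate (p + q) y) = S (replicate p y) * T (replicate q y)"
proof -
  have perm: "permute_list \<sigma> (replicate (p + q) y) = replicate (p + q) y" if "\<sigma> permutes {..<p + q}" for \<sigma>
    using set_permute_list[of \<sigma> "replicate (p + q) y"] that
    by (intro replicate_eqI) auto
  have "(\<Sum>k\<le>p + q. S (take k (replicate (p + q) y)) * T (drop k (replicate (p + q) y)))
      = (\<Sum>k\<le>p + q. if k = p then S (replicate p y) * T (replicate q y) else 0)"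
    by (intro sum.cong) (auto simp: S)
  then show ?thesis
    by (simp add: sym_prod_def perm card_permutations)
qed

lemma sym_power_diagonal: "sym_power x r (replicate r y) = (x \<bullet> y) ^ r"
proof (induction r)
  case (Suc r)
  have "sym_power x (Suc r) (replicate (1 + r) y) = vec_tensor x (replicate 1 y) * sym_power x r (replicate r y)"
    unfolding sym_power.simps by (rule sym_prod_diagonal) (simp add: vec_tensor_def)
  then show ?case by (simp add: Suc vec_tensor_def)
qed (simp add: one_tensor_def)

text \<open>
  On the diagonal symmetric products become products of real numbers, and the double integral over
  an edge and its normals factorizes. The indicator of \<open>Sigma3\<close> is \<open>1\<close> because normals are unit vectors.
\<close>

lemma phi_polytope_diagonal:
  "phi_polytope r s P Sigma3 (replicate (r + s + 2) y)
   = (\<Sum>F | F edge_of P. (edge_direction F \<bullet> y)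
        * (LINT x:F|hausdorff_measure 1. (x \<bullet> y) ^ r)
        * (LINT u:unit_normals P F|hausdorff_measure 1.
             (cross3 (edge_direction F) u \<bullet> y) * (u \<bullet> y) ^ s))"
proof -
  let ?H = "hausdorff_measure 1 :: (real^3) measure"
  have *: "(sym_power x r \<odot> vec_tensor w \<odot> sym_power u s) (replicate (r + (1 + s)) y)
      = (x \<bullet> y) ^ r * ((w \<bullet> y) * (u \<bullet> y) ^ s)" for x w u
    by (subst sym_prod_diagonal, simp add: sym_power_rank)
      (subst sym_prod_diagonal, auto simp: vec_tensor_def sym_power_diagonal)
  have normals: "indicator (unit_normals P F) u *\<^sub>R (indicator Sigma3 (x, u) * c)
      = indicator (unit_normals P F) u *\<^sub>R c" for F x u and c :: real
    by (simp add: indicator_def Sigma3_def unit_normals_def)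
  have "(vec_tensor v \<odot> (\<lambda>zs. LINT x:F|?H. LINT u:unit_normals P F|?H.
        indicator Sigma3 (x, u) * (sym_power x r \<odot> vec_tensor (cross3 v u) \<odot> sym_power u s) zs))
        (replicate (1 + (r + (1 + s))) y)
      = (v \<bullet> y) * (LINT x:F|?H. (x \<bullet> y) ^ r)
        * (LINT u:unit_normals P F|?H. (cross3 v u \<bullet> y) * (u \<bullet> y) ^ s)" for v F
  proof -
    have "(LINT x:F|?H. LINT u:unit_normals P F|?H. indicator Sigma3 (x, u) *
          (sym_power x r \<odot> vec_tensor (cross3 v u) \<odot> sym_power u s) (replicate (r + (1 + s)) y))
        = (LINT x:F|?H. LINT u:unit_normals P F|?H. (x \<bullet> y) ^ r * ((cross3 v u \<bullet> y) * (u \<bullet> y) ^ s))"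
      unfolding * set_lebesgue_integral_def normals ..
    also have "\<dots> = (LINT x:F|?H. (x \<bullet> y) ^ r)
        * (LINT u:unit_normals P F|?H. (cross3 v u \<bullet> y) * (u \<bullet> y) ^ s)"
      by simp
    finally show ?thesis
      by (subst sym_prod_diagonal) (simp_all add: vec_tensor_def)
  qed
  then show ?thesis
    by (simp add: phi_polytope_def Let_def)
qed

text \<open>
  Integrating the constant \<open>1\<close> turns weak continuity of the measures into continuity of the total
  values.
\<close>

lemma has_signed_integral_one:
  assumes "has_signed_integral X \<mu> (\<lambda>_. 1) I"
  shows "I = \<mu> (space X)"
proof -
  obtain M N where "finite_measure M" "finite_measure N" "sets M = sets X" "sets N = sets X"
    "\<forall>A\<in>sets X. \<mu> A = measure M A - measure N A" "I = (LINT x|M. 1) - (LINT x|N. 1)"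
    using assms unfolding has_signed_integral_def by blast
  moreover from this have "space M = space X" "space N = space X"
    by (auto dest: sets_eq_imp_space_eq)
  ultimately show ?thesis by simp
qed

section \<open>Flags of a three-dimensional polytope\<close>

text \<open>
  A proper face of the facet \<open>G\<close> has dimension at most that of the ridge \<open>R\<close>, so the face \<open>G \<inter> H\<close>
  cannot be larger than \<open>R\<close>.
\<close>

lemma ridge_facet_Int:
  fixes P :: "'a::euclidean_space set"
  assumes R: "R face_of P" "aff_dim R = aff_dim P - 2"
    and G: "G facet_of P" "H facet_of P" "R \<subseteq> G" "R \<subseteq> H" "G \<noteq> H"
  shows "G \<inter> H = R"
proof (rule ccontr)
  assume ne: "G \<inter> H \<noteq> R"
  have face: "G face_of P" "H face_of P" and dim: "aff_dim G = aff_dim P - 1" "aff_dim H = aff_dim P - 1"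
    using G by (auto simp: facet_of_def)
  have conv: "convex G" "convex H" "convex (G \<inter> H)"
    using face face_of_imp_convex by (blast intro: convex_Int)+
  have GH: "G \<inter> H face_of P" using face by (rule face_of_Int)
  have "G \<inter> H \<noteq> G"
  proof
    assume "G \<inter> H = G"
    then have "G face_of H"
      using face by (metis Int_lower2 face_of_imp_subset face_of_subset)
    then show False
      using face_of_aff_dim_lt[OF conv(2), of G] G(5) dim by simp
  qed
  moreover have "G \<inter> H face_of G"
    using GH face by (meson Int_lower1 face_of_imp_subset face_of_subset)
  ultimately have "aff_dim (G \<inter> H) < aff_dim P - 1"
    using face_of_aff_dim_lt[OF conv(1)] dim by metis
  moreover have "R face_of G \<inter> H"
    using R(1) G GH by (meson Int_greatest face_of_imp_subset face_of_subset)
  ultimately show False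
    using face_of_aff_dim_lt[OF conv(3), of R] ne R(2) by simp
qed

text \<open>
  A proper face is the intersection of the facets that contain it. The lemma is used twice: for an edge of
  a three-dimensional polytope, and for a vertex of a polygon.
\<close>

lemma ridge_two_facets:
  fixes P :: "'a::euclidean_space set"
  assumes P: "polytope P" and R: "R face_of P" "R \<noteq> {}" "aff_dim R = aff_dim P - 2"
  obtains G H where "G facet_of P" "H facet_of P" "G \<noteq> H" "G \<inter> H = R"
proof -
  let ?S = "{F. F facet_of P \<and> R \<subseteq> F}"
  have "R \<noteq> P" using R(3) by auto
  then have Inter: "R = \<Inter>?S"
    using face_of_polyhedron[OF polytope_imp_polyhedron[OF P] R(1,2)] by simp
  obtain G where G: "G \<in> ?S"
    using face_of_polyhedron_subset_facet[OF polytope_imp_polyhedron[OF P] R(1,2) \<open>R \<noteq> P\<close>] by blast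
  have "\<exists>H \<in> ?S. H \<noteq> G"
  proof (rule ccontr)
    assume "\<not> ?thesis"
    then have "?S = {G}" using G by blast
    then have "R = G" using Inter by simp
    then show False using G R(3) by (simp add: facet_of_def)
  qed
  then show ?thesis using that ridge_facet_Int[OF R(1,3)] G by blast
qed

lemma norm_cross3_orthonormal:
  fixes v e :: "real^3"
  assumes "norm v = 1" "norm e = 1" "v \<bullet> e = 0"
  shows "norm (cross3 v e) = 1"
  using norm_cross_dot[of v e] assms by (simp add: power2_eq_1_iff) (smt (verit) norm_ge_zero)

lemma norm_orthonormal_combination:
  fixes e f :: "'a::real_inner"
  assumes "norm e = 1" "norm f = 1" "e \<bullet> f = 0"
  shows "(norm (x *\<^sub>R e + y *\<^sub>R f))\<^sup>2 = x\<^sup>2 + y\<^sup>2"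
proof -
  have "e \<bullet> e = 1" "f \<bullet> f = 1" "f \<bullet> e = 0"
    using assms by (simp_all add: norm_eq_1 inner_commute)
  then show ?thesis
    unfolding power2_norm_eq_inner using assms(3)
    by (simp add: inner_add_left inner_add_right power2_eq_square)
qed

lemma orthonormal_expansion:
  fixes v e w :: "real^3"
  assumes v: "norm v = 1" and e: "norm e = 1" and ve: "v \<bullet> e = 0" and vw: "v \<bullet> w = 0"
  shows "w = (w \<bullet> e) *\<^sub>R e + (w \<bullet> cross3 v e) *\<^sub>R cross3 v e"
proof -
  have f: "norm (cross3 v e) = 1" using v e ve by (rule norm_cross3_orthonormal)
  define z where "z = w - ((w \<bullet> e) *\<^sub>R e + (w \<bullet> cross3 v e) *\<^sub>R cross3 v e)"
  have "e \<bullet> v = 0" "w \<bullet> v = 0" using ve vw by (simp_all add: inner_commute)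
  then have "z \<bullet> v = 0" "z \<bullet> e = 0" "z \<bullet> cross3 v e = 0"
    using ve vw e f unfolding z_def
    by (simp_all add: inner_diff_left inner_add_left dot_cross_self dot_square_norm)
  then have "cross3 z (cross3 v e) = 0" "z \<bullet> cross3 v e = 0"
    by (simp_all add: Lagrange)
  then have "norm z = 0" using norm_cross_dot[of z "cross3 v e"] f by simp
  then show ?thesis by (simp add: z_def)
qed

text \<open>
  The outer unit normal vector of a full-dimensional polytope \<open>P\<close> at its facet \<open>G\<close>.
\<close>

definition facet_normal :: "(real^3) set \<Rightarrow> (real^3) set \<Rightarrow> real^3" where
  "facet_normal P G =
     (SOME n. norm n = 1 \<and> (\<exists>c. P \<subseteq> {x. n \<bullet> x \<le> c} \<and> G = P \<inter> {x. n \<bullet> x = c}))"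

lemma facet_normal:
  assumes P: "polytope P" and G: "G facet_of P"
  shows norm_facet_normal: "norm (facet_normal P G) = 1"
    and facet_normal_le: "\<And>p x. p \<in> P \<Longrightarrow> x \<in> G \<Longrightarrow> facet_normal P G \<bullet> (p - x) \<le> 0"
    and facet_normal_eq_0_iff: "\<And>p x. p \<in> P \<Longrightarrow> x \<in> G \<Longrightarrow> facet_normal P G \<bullet> (p - x) = 0 \<longleftrightarrow> p \<in> G"
proof -
  obtain a b where ab: "a \<noteq> 0" "P \<subseteq> {x. a \<bullet> x \<le> b}" "G = P \<inter> {x. a \<bullet> x = b}"
    using facet_of_polyhedron[OF polytope_imp_polyhedron[OF P] G] by metis
  have "norm (a /\<^sub>R norm a) = 1 \<and>
      (\<exists>c. P \<subseteq> {x. (a /\<^sub>R norm a) \<bullet> x \<le> c} \<and> G = P \<inter> {x. (a /\<^sub>R norm a) \<bullet> x = c})"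
    using ab by (intro conjI exI[of _ "b / norm a"]) (auto simp: field_simps)
  from someI[of "\<lambda>n. norm n = 1 \<and> (\<exists>c. P \<subseteq> {x. n \<bullet> x \<le> c} \<and> G = P \<inter> {x. n \<bullet> x = c})", OF this]
  obtain c where c: "norm (facet_normal P G) = 1" "P \<subseteq> {x. facet_normal P G \<bullet> x \<le> c}"
    "G = P \<inter> {x. facet_normal P G \<bullet> x = c}"
    unfolding facet_normal_def by auto
  have "x \<in> G \<longleftrightarrow> x \<in> P \<and> facet_normal P G \<bullet> x = c" for x using c(3) by blast
  with c(1,2) show "norm (facet_normal P G) = 1"
    "\<And>p x. p \<in> P \<Longrightarrow> x \<in> G \<Longrightarrow> facet_normal P G \<bullet> (p - x) \<le> 0"
    "\<And>p x. p \<in> P \<Longrightarrow> x \<in> G \<Longrightarrow> facet_normal P G \<bullet> (p - x) = 0 \<longleftrightarrow> p \<in> G"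
    by (auto simp: inner_diff_right)
qed

text \<open>
  The end points are named such that the chosen direction of the edge points from \<open>a\<close> to \<open>b\<close>.
\<close>

lemma edge_eq_segment:
  assumes P: "polytope P" and F: "F edge_of P"
  obtains a b where "a \<noteq> b" "F = closed_segment a b" "edge_direction F = (b - a) /\<^sub>R norm (b - a)"
proof -
  have "polytope F" "aff_dim F = 1"
    using P F face_of_polytope_polytope by (auto simp: edge_of_def)
  then obtain a b where F: "F = closed_segment a b"
    using compact_convex_collinear_segment[of F]
    by (metis aff_dim_empty collinear_aff_dim order_refl polytope_imp_compact polytope_imp_convex
        zero_neq_neg_one zero_neq_one one_neq_neg_one)
  then have ab: "a \<noteq> b" using \<open>aff_dim F = 1\<close> by auto
  let ?v = "(b - a) /\<^sub>R norm (b - a)"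
  have hull: "affine hull F = (\<lambda>t. a + t *\<^sub>R (b - a)) ` UNIV"
    unfolding F segment_convex_hull affine_hull_convex_hull affine_hull_2_alt by auto
  have "norm ?v = 1 \<and> affine_parallel (affine hull F) (span {?v})"
  proof
    show "affine_parallel (affine hull F) (span {?v})"
      unfolding affine_parallel_def
    proof (rule exI[of _ "- a"], rule equalityI; clarify)
      fix x assume "x \<in> span {?v}"
      then obtain k where "x = k *\<^sub>R ?v" by (auto simp: span_singleton)
      then show "x \<in> (+) (- a) ` (affine hull F)"
        unfolding hull by (auto simp: image_iff intro!: exI[of _ "k / norm (b - a)"])
    next
      fix x assume "x \<in> affine hull F"
      then obtain t where "x = a + t *\<^sub>R (b - a)" using hull by auto
      then have "- a + x = (t * norm (b - a)) *\<^sub>R ?v" using ab by simp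
      then show "- a + x \<in> span {?v}" by (metis span_base span_scale singletonI)
    qed
  qed (use ab in simp)
  then have dir: "norm (edge_direction F) = 1" "affine_parallel (affine hull F) (span {edge_direction F})"
    using someI_ex[of "\<lambda>v. norm v = 1 \<and> affine_parallel (affine hull F) (span {v})"]
    unfolding edge_direction_def by blast+
  from dir(2) obtain w where "span {edge_direction F} = (+) w ` (affine hull F)"
    by (auto simp: affine_parallel_def)
  moreover have "a \<in> affine hull F" "b \<in> affine hull F" by (simp_all add: F hull_inc)
  ultimately have "(w + b) - (w + a) \<in> span {edge_direction F}"
    by (intro span_diff) auto
  then obtain k where k: "b - a = k *\<^sub>R edge_direction F" by (auto simp: span_singleton)
  then have norm: "norm (b - a) = \<bar>k\<bar>" using dir(1) by simp
  have "k \<noteq> 0" using k ab by auto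
  show thesis
  proof (cases "k > 0")
    case True
    then show ?thesis using that[OF ab F] k norm by simp
  next
    case False
    have "edge_direction F = (a - b) /\<^sub>R norm (a - b)"
      using False \<open>k \<noteq> 0\<close> k norm
      by (simp add: norm_minus_commute[of a b] minus_diff_eq[of b a, symmetric] del: minus_diff_eq)
    then show ?thesis using that[of b a] ab F by (simp add: closed_segment_commute)
  qed
qed

text \<open>
  The two facets at an edge, in the order in which their normals \<open>n\<^sub>1\<close>, \<open>n\<^sub>2\<close> follow each other
  in the positive rotation about \<open>v\<close>. Both normals are orthogonal to \<open>v\<close>, and they are
  independent since otherwise \<open>G1\<close> and \<open>G2\<close> would have common points off the edge. A normal \<open>u\<close> at the edge is orthogonal to \<open>v\<close> too, hence
  a combination of \<open>n\<^sub>1\<close> and \<open>n\<^sub>2\<close>; testing \<open>u\<close> with a point of either facet off the edge shows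
  that the coefficients are nonnegative. The normal of a third facet at the edge would be such a
  combination as well, which would put its points off the edge into \<open>G1\<close> or \<open>G2\<close>. In the plane of a facet, the
  polygon lies on one side of the edge, and the last two clauses say that the sides are opposite
  for the two facets.
\<close>

lemma edge_facet_pair:
  assumes P: "polytope P" and dim: "aff_dim P = 3" and F: "F edge_of P"
    and seg: "F = closed_segment a b" "a \<noteq> b" and v: "v = (b - a) /\<^sub>R norm (b - a)"
  obtains G1 G2 where "G1 \<noteq> G2" "{G. G facet_of P \<and> F \<subseteq> G} = {G1, G2}"
    "cross3 v (facet_normal P G1) \<bullet> facet_normal P G2 > 0"
    "v \<bullet> facet_normal P G1 = 0" "v \<bullet> facet_normal P G2 = 0"
    "normal_cone P F = {\<alpha> *\<^sub>R facet_normal P G1 + \<beta> *\<^sub>R facet_normal P G2 | \<alpha> \<beta>. 0 \<le> \<alpha> \<and> 0 \<le> \<beta>}"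
    "\<And>p. p \<in> G1 - F \<Longrightarrow> cross3 v (facet_normal P G1) \<bullet> (p - a) < 0"
    "\<And>p. p \<in> G2 - F \<Longrightarrow> cross3 v (facet_normal P G2) \<bullet> (p - a) > 0"
proof -
  let ?n = "facet_normal P"
  have face: "F face_of P" "F \<noteq> {}" "aff_dim F = aff_dim P - 2"
    using F dim seg by (auto simp: edge_of_def)
  have abF: "a \<in> F" "b \<in> F" using seg by auto
  have norm_v: "norm v = 1" using seg v by simp
  have orth: "v \<bullet> ?n G = 0" if "G facet_of P" "F \<subseteq> G" for G
  proof -
    have "?n G \<bullet> (b - a) = 0"
      using that abF facet_of_imp_subset[OF that(1)] facet_normal_eq_0_iff[OF P that(1)] by blast
    then show ?thesis by (simp add: v inner_commute)
  qed
  have outside: "\<exists>p. p \<in> G - F" if "G facet_of P" "F \<subseteq> G" for G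
    using that face dim by (auto simp: facet_of_def dest: equalityI)
  have neg: "?n G \<bullet> (p - a) < 0" if "G facet_of P" "F \<subseteq> G" "p \<in> P - G" for G p
    using that abF facet_normal_le[OF P that(1), of p a] facet_normal_eq_0_iff[OF P that(1), of p a]
    by force
  have sub: "G \<subseteq> P" if "G facet_of P" for G using that by (rule facet_of_imp_subset)
  have zero: "?n G \<bullet> (p - a) = 0" if "G facet_of P" "F \<subseteq> G" "p \<in> G" for G p
    using that abF sub facet_normal_eq_0_iff[OF P that(1), of p a] by blast
  \<comment> \<open>Otherwise the normals would be parallel, and a point of \<open>G\<close> off the edge would be a common
    point of both facets.\<close>
  have indep: "cross3 v (?n G) \<bullet> ?n H \<noteq> 0"
    if GH: "G facet_of P" "H facet_of P" "F \<subseteq> G" "F \<subseteq> H" "G \<noteq> H" for G H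
  proof
    assume "cross3 v (?n G) \<bullet> ?n H = 0"
    then have par: "?n H = (?n H \<bullet> ?n G) *\<^sub>R ?n G"
      using orthonormal_expansion[OF norm_v norm_facet_normal[OF P GH(1)] orth[OF GH(1,3)] orth[OF GH(2,4)]]
      by (simp add: inner_commute)
    obtain p where p: "p \<in> G - F" using outside GH by blast
    have "?n H \<bullet> (p - a) = 0"
      by (subst par) (use zero[of G p] GH p in simp)
    then have "p \<in> H"
      using facet_normal_eq_0_iff[OF P GH(2), of p a] p sub[OF GH(1)] GH abF by blast
    then show False using p ridge_facet_Int[OF face(1,3) GH(1-5)] by blast
  qed
  obtain H1 H2 where H: "H1 facet_of P" "H2 facet_of P" "H1 \<noteq> H2" "H1 \<inter> H2 = F"
    using ridge_two_facets[OF P face] .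
  have skew: "cross3 v x \<bullet> y = - (cross3 v y \<bullet> x)" for x y
    by (simp add: cross3_simps)
  obtain G1 G2 where G: "G1 facet_of P" "G2 facet_of P" "G1 \<noteq> G2" "G1 \<inter> G2 = F"
      and pos: "cross3 v (?n G1) \<bullet> ?n G2 > 0"
  proof (cases "cross3 v (?n H1) \<bullet> ?n H2 > 0")
    case True
    then show ?thesis using that H by blast
  next
    case False
    have "cross3 v (?n H1) \<bullet> ?n H2 \<noteq> 0" using indep H by blast
    then have "cross3 v (?n H2) \<bullet> ?n H1 > 0" using False skew[of "?n H1" "?n H2"] by linarith
    then show ?thesis using that[of H2 H1] H by blast
  qed
  have FG: "F \<subseteq> G1" "F \<subseteq> G2" using G(4) by auto
  note n1 = norm_facet_normal[OF P G(1)] and n2 = norm_facet_normal[OF P G(2)]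
  note o1 = orth[OF G(1) FG(1)] and o2 = orth[OF G(2) FG(2)]
  have neg12: "?n G2 \<bullet> (p - a) < 0" if "p \<in> G1 - F" for p
    using neg[OF G(2) FG(2), of p] that sub[OF G(1)] G(4) by blast
  have neg21: "?n G1 \<bullet> (p - a) < 0" if "p \<in> G2 - F" for p
    using neg[OF G(1) FG(1), of p] that sub[OF G(2)] G(4) by blast
  obtain p1 p2 where p: "p1 \<in> G1 - F" "p2 \<in> G2 - F" using outside G FG by meson
  have comb: "\<exists>\<alpha> \<beta>. u = \<alpha> *\<^sub>R ?n G1 + \<beta> *\<^sub>R ?n G2 \<and> 0 \<le> \<alpha> \<and> 0 \<le> \<beta>" if u: "u \<in> normal_cone P F" for u
  proof -
    have "a \<in> P" "b \<in> P" using abF face(1) face_of_imp_subset by blast+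
    then have "u \<bullet> (b - a) \<le> 0" "u \<bullet> (a - b) \<le> 0"
      using u abF unfolding normal_cone_def by blast+
    then have "u \<bullet> (b - a) = 0" by (simp add: inner_diff_right)
    then have ou: "v \<bullet> u = 0" by (simp add: v inner_commute)
    let ?f = "cross3 v (?n G1)"
    define \<beta> where "\<beta> = (u \<bullet> ?f) / (?n G2 \<bullet> ?f)"
    define \<alpha> where "\<alpha> = u \<bullet> ?n G1 - \<beta> * (?n G2 \<bullet> ?n G1)"
    have nz: "?n G2 \<bullet> ?f \<noteq> 0" using pos by (simp add: inner_commute)
    have "\<alpha> *\<^sub>R ?n G1 + \<beta> *\<^sub>R ?n G2
        = \<alpha> *\<^sub>R ?n G1 + \<beta> *\<^sub>R ((?n G2 \<bullet> ?n G1) *\<^sub>R ?n G1 + (?n G2 \<bullet> ?f) *\<^sub>R ?f)"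
      using orthonormal_expansion[OF norm_v n1 o1 o2] by simp
    also have "\<dots> = (u \<bullet> ?n G1) *\<^sub>R ?n G1 + (u \<bullet> ?f) *\<^sub>R ?f"
      using nz by (simp add: \<alpha>_def \<beta>_def algebra_simps)
    also have "\<dots> = u" using orthonormal_expansion[OF norm_v n1 o1 ou] by simp
    finally have u_eq: "u = \<alpha> *\<^sub>R ?n G1 + \<beta> *\<^sub>R ?n G2" by simp
    have "u \<bullet> (p1 - a) \<le> 0" "u \<bullet> (p2 - a) \<le> 0"
      using u abF p sub[OF G(1)] sub[OF G(2)] unfolding normal_cone_def by blast+
    then have "\<beta> * (?n G2 \<bullet> (p1 - a)) \<le> 0" "\<alpha> * (?n G1 \<bullet> (p2 - a)) \<le> 0"
      using zero[OF G(1) FG(1), of p1] zero[OF G(2) FG(2), of p2] p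
      by (simp_all add: u_eq inner_add_left)
    then have "0 \<le> \<beta>" "0 \<le> \<alpha>"
      using neg12[OF p(1)] neg21[OF p(2)] by (auto simp: mult_le_0_iff)
    then show ?thesis using u_eq by blast
  qed
  have in_cone: "?n G \<in> normal_cone P F" if "G facet_of P" "F \<subseteq> G" for G
    using facet_normal_le[OF P that(1)] that(2) by (auto simp: normal_cone_def)
  have cone: "normal_cone P F = {\<alpha> *\<^sub>R ?n G1 + \<beta> *\<^sub>R ?n G2 | \<alpha> \<beta>. 0 \<le> \<alpha> \<and> 0 \<le> \<beta>}"
  proof (intro equalityI subsetI)
    fix u assume "u \<in> {\<alpha> *\<^sub>R ?n G1 + \<beta> *\<^sub>R ?n G2 | \<alpha> \<beta>. 0 \<le> \<alpha> \<and> 0 \<le> \<beta>}"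
    then show "u \<in> normal_cone P F"
      using in_cone[OF G(1) FG(1)] in_cone[OF G(2) FG(2)]
      by (auto simp: normal_cone_def inner_add_left intro!: add_nonpos_nonpos mult_nonneg_nonpos)
  qed (use comb in auto)
  have only: "G \<in> {G1, G2}" if G': "G facet_of P" "F \<subseteq> G" for G
  proof (rule ccontr)
    assume ne: "G \<notin> {G1, G2}"
    have int: "G \<inter> G1 = F" "G \<inter> G2 = F"
      using ridge_facet_Int[OF face(1,3)] G' G FG ne by blast+
    obtain \<alpha> \<beta> where ab: "?n G = \<alpha> *\<^sub>R ?n G1 + \<beta> *\<^sub>R ?n G2" "0 \<le> \<alpha>" "0 \<le> \<beta>"
      using comb in_cone[OF G'] by blast
    have "?n G \<bullet> (p2 - a) < 0"
      using neg[OF G', of p2] p int sub[OF G(2)] by blast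
    then have "\<alpha> \<noteq> 0" using zero[OF G(2) FG(2), of p2] p by (auto simp: ab inner_add_left)
    obtain q where q: "q \<in> G - F" using outside[OF G'] by blast
    have "\<alpha> * (?n G1 \<bullet> (q - a)) + \<beta> * (?n G2 \<bullet> (q - a)) = 0"
      using zero[OF G', of q] q by (simp add: ab inner_add_left)
    moreover have "?n G2 \<bullet> (q - a) \<le> 0" "?n G1 \<bullet> (q - a) < 0"
      using neg[OF G(1) FG(1), of q] neg[OF G(2) FG(2), of q] q int sub[OF G'(1)] by force+
    ultimately show False
      using ab(2,3) \<open>\<alpha> \<noteq> 0\<close> by (smt (verit) mult_nonneg_nonpos mult_pos_neg)
  qed
  show thesis
  proof (rule that[OF G(3) _ pos o1 o2 cone])
    show "{G. G facet_of P \<and> F \<subseteq> G} = {G1, G2}" using only G FG by blast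
    show "cross3 v (?n G1) \<bullet> (p - a) < 0" if "p \<in> G1 - F" for p
    proof -
      have "?n G2 \<bullet> (p - a) = (?n G2 \<bullet> cross3 v (?n G1)) * (cross3 v (?n G1) \<bullet> (p - a))"
        by (subst orthonormal_expansion[OF norm_v n1 o1 o2])
          (use zero[OF G(1) FG(1), of p] that in \<open>simp add: inner_add_left\<close>)
      then show ?thesis
        using neg12[OF that] pos by (simp add: inner_commute mult_less_0_iff)
    qed
    show "cross3 v (?n G2) \<bullet> (p - a) > 0" if "p \<in> G2 - F" for p
    proof -
      have "?n G1 \<bullet> (p - a) = (?n G1 \<bullet> cross3 v (?n G2)) * (cross3 v (?n G2) \<bullet> (p - a))"
        by (subst orthonormal_expansion[OF norm_v n2 o2 o1])
          (use zero[OF G(2) FG(2), of p] that in \<open>simp add: inner_add_left\<close>)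
      moreover have "?n G1 \<bullet> cross3 v (?n G2) < 0"
        using pos skew[of "?n G1" "?n G2"] by (simp add: inner_commute)
      ultimately show ?thesis
        using neg21[OF that] by (simp add: mult_less_0_iff)
    qed
  qed
qed

text \<open>
  A flag is a vertex \<open>c\<close> of an edge \<open>F\<close> of a facet \<open>G\<close>. With \<open>d\<close> on the edge and \<open>p\<close> in the facet
  but off the edge, the sign is the orientation of the triple \<open>(c - d, n, p - c)\<close> with the normal
  \<open>n\<close> of the facet: it tells whether \<open>F\<close>, in the orientation induced by \<open>G\<close>, runs towards \<open>c\<close> or
  away from it. By the lemma \<open>flag_sign\<close> below, the choice of \<open>d\<close> and \<open>p\<close> is irrelevant.
\<close>

definition flag_sign :: "(real^3) set \<Rightarrow> real^3 \<Rightarrow> (real^3) set \<Rightarrow> (real^3) set \<Rightarrow> real" where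
  "flag_sign P c F G =
     sgn (cross3 (c - (SOME d. d \<in> F - {c})) (facet_normal P G) \<bullet> ((SOME p. p \<in> G - F) - c))"

lemma flag_sign_eqI:
  assumes "\<And>d p. d \<in> F - {c} \<Longrightarrow> p \<in> G - F \<Longrightarrow> sgn (cross3 (c - d) (facet_normal P G) \<bullet> (p - c)) = \<epsilon>"
    and "d0 \<in> F - {c}" "p0 \<in> G - F"
  shows "flag_sign P c F G = \<epsilon>"
  unfolding flag_sign_def
  by (rule assms(1)[OF someI[of "\<lambda>d. d \<in> F - {c}", OF assms(2)] someI[of "\<lambda>p. p \<in> G - F", OF assms(3)]])

text \<open>
  As \<open>d\<close> varies in the edge, \<open>b - d\<close> is a positive and \<open>a - d\<close> a negative multiple of \<open>v\<close>. So
  the flag sign is, up to this sign, the side of the edge on which the facet lies.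
\<close>

lemma flag_sign_segment:
  assumes seg: "a \<noteq> b" and v: "v = (b - a) /\<^sub>R norm (b - a)"
    and \<epsilon>: "\<And>p. p \<in> G - closed_segment a b \<Longrightarrow> sgn (cross3 v (facet_normal P G) \<bullet> (p - a)) = \<epsilon>"
    and p0: "p0 \<in> G - closed_segment a b"
  shows "\<And>d p. d \<in> closed_segment a b - {b} \<Longrightarrow> p \<in> G - closed_segment a b \<Longrightarrow>
        sgn (cross3 (b - d) (facet_normal P G) \<bullet> (p - b)) = \<epsilon>" (is "\<And>d p. _ \<Longrightarrow> _ \<Longrightarrow> ?B d p")
    and "\<And>d p. d \<in> closed_segment a b - {a} \<Longrightarrow> p \<in> G - closed_segment a b \<Longrightarrow>
        sgn (cross3 (a - d) (facet_normal P G) \<bullet> (p - a)) = - \<epsilon>" (is "\<And>d p. _ \<Longrightarrow> _ \<Longrightarrow> ?A d p")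
    and "flag_sign P b (closed_segment a b) G = \<epsilon>"
    and "flag_sign P a (closed_segment a b) G = - \<epsilon>"
proof -
  let ?n = "facet_normal P G"
  have ba: "b - a = norm (b - a) *\<^sub>R v" using seg v by simp
  show B: "?B d p" if d: "d \<in> closed_segment a b - {b}" and p: "p \<in> G - closed_segment a b" for d p
  proof -
    obtain u where u: "0 \<le> u" "u \<le> 1" "d = (1 - u) *\<^sub>R a + u *\<^sub>R b"
      using d by (auto simp: in_segment)
    then have "b - d = (1 - u) *\<^sub>R (b - a)" by (simp add: algebra_simps)
    then have bd: "b - d = ((1 - u) * norm (b - a)) *\<^sub>R v"
      unfolding scaleR_scaleR[symmetric] ba[symmetric] .
    have "u \<noteq> 1" using d u(3) by auto
    have pb: "p - b = (p - a) - norm (b - a) *\<^sub>R v" using ba by (simp add: algebra_simps)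
    have "cross3 (b - d) ?n \<bullet> (p - b) = ((1 - u) * norm (b - a)) * (cross3 v ?n \<bullet> (p - a))"
      unfolding bd pb by (simp add: cross_mult_left inner_diff_right dot_cross_self inner_commute)
    then show ?thesis
      using \<epsilon>[OF p] seg u(2) \<open>u \<noteq> 1\<close> by (simp add: sgn_mult)
  qed
  show A: "?A d p" if d: "d \<in> closed_segment a b - {a}" and p: "p \<in> G - closed_segment a b" for d p
  proof -
    obtain u where u: "0 \<le> u" "u \<le> 1" "d = (1 - u) *\<^sub>R a + u *\<^sub>R b"
      using d by (auto simp: in_segment)
    then have "a - d = (- u) *\<^sub>R (b - a)" by (simp add: algebra_simps)
    then have ad: "a - d = (- u * norm (b - a)) *\<^sub>R v"
      unfolding scaleR_scaleR[symmetric] ba[symmetric] .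
    have "u \<noteq> 0" using d u(3) by auto
    have "cross3 (a - d) ?n \<bullet> (p - a) = (- u * norm (b - a)) * (cross3 v ?n \<bullet> (p - a))"
      unfolding ad by (simp add: cross_mult_left)
    then show ?thesis
      using \<epsilon>[OF p] seg u(1) \<open>u \<noteq> 0\<close> by (simp add: sgn_mult)
  qed
  show "flag_sign P b (closed_segment a b) G = \<epsilon>"
    by (rule flag_sign_eqI[OF B _ p0, of a]) (use seg in auto)
  show "flag_sign P a (closed_segment a b) G = - \<epsilon>"
    by (rule flag_sign_eqI[OF A _ p0, of b]) (use seg in auto)
qed

lemma flag_sign:
  assumes P: "polytope P" and dim: "aff_dim P = 3" and F: "F edge_of P" and G: "G facet_of P" "F \<subseteq> G"
    and c: "c extreme_point_of F" and d: "d \<in> F - {c}" and p: "p \<in> G - F"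
  shows "flag_sign P c F G = sgn (cross3 (c - d) (facet_normal P G) \<bullet> (p - c))"
    and "flag_sign P c F G \<noteq> 0"
proof -
  obtain a b where ab: "a \<noteq> b" "F = closed_segment a b" "edge_direction F = (b - a) /\<^sub>R norm (b - a)"
    using edge_eq_segment[OF P F] .
  define v where "v = (b - a) /\<^sub>R norm (b - a)"
  obtain G1 G2 where G12: "{G. G facet_of P \<and> F \<subseteq> G} = {G1, G2}"
    "\<And>p. p \<in> G1 - F \<Longrightarrow> cross3 v (facet_normal P G1) \<bullet> (p - a) < 0"
    "\<And>p. p \<in> G2 - F \<Longrightarrow> cross3 v (facet_normal P G2) \<bullet> (p - a) > 0"
    by (rule edge_facet_pair[OF P dim F ab(2,1) v_def]) (rule that)
  have "G = G1 \<or> G = G2" using G G12(1) by blast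
  then have "sgn (cross3 v (facet_normal P G) \<bullet> (p - a)) = (if G = G1 then - 1 else 1)" if "p \<in> G - F" for p
    using G12(2)[of p] G12(3)[of p] that by auto
  moreover define \<epsilon> :: real where "\<epsilon> = (if G = G1 then - 1 else 1)"
  ultimately have \<epsilon>: "\<epsilon> \<noteq> 0"
      "\<And>p. p \<in> G - closed_segment a b \<Longrightarrow> sgn (cross3 v (facet_normal P G) \<bullet> (p - a)) = \<epsilon>"
    using ab(2) by auto
  have "c = a \<or> c = b" using c ab by (simp add: extreme_point_of_segment)
  then show "flag_sign P c F G = sgn (cross3 (c - d) (facet_normal P G) \<bullet> (p - c))"
    and "flag_sign P c F G \<noteq> 0"
    using flag_sign_segment[OF ab(1) v_def \<epsilon>(2), of p] d p \<epsilon>(1) unfolding ab(2) by auto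
qed

text \<open>
  Within the polygon \<open>G\<close> the vertex \<open>c\<close> is a ridge, and any two edges at \<open>c\<close> meet only in \<open>c\<close>. For
  two such edges a point of the one serves as the point off the other, and the signs are opposite
  because the triple product is alternating. As three nonzero numbers cannot be pairwise opposite,
  there are exactly two edges.
\<close>

lemma flag_signs_cancel:
  assumes P: "polytope P" and dim: "aff_dim P = 3" and G: "G facet_of P"
  shows "(\<Sum>F | F edge_of P \<and> F \<subseteq> G \<and> c extreme_point_of F. flag_sign P c F G) = 0"
proof (cases "{F. F edge_of P \<and> F \<subseteq> G \<and> c extreme_point_of F} = {}")
  case True
  then show ?thesis by (simp only: sum.empty)
next
  case False
  let ?A = "{F. F edge_of P \<and> F \<subseteq> G \<and> c extreme_point_of F}"
  have Gf: "G face_of P" "G \<subseteq> P" "aff_dim G = 2" "polytope G"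
    using facet_of_imp_subset[OF G] G P dim face_of_polytope_polytope by (auto simp: facet_of_def)
  obtain F0 where "F0 \<in> ?A" using False by blast
  then have "{c} face_of F0" "F0 face_of P" "F0 \<subseteq> G"
    by (auto simp: edge_of_def face_of_singleton)
  then have cP: "{c} face_of P" and cG: "c \<in> G"
    using face_of_trans face_of_imp_subset by blast+
  then have "{c} face_of G" using Gf(2) by (blast intro: face_of_subset)
  have A: "F \<in> ?A \<longleftrightarrow> F facet_of G \<and> c \<in> F" for F
  proof
    assume "F \<in> ?A"
    then show "F facet_of G \<and> c \<in> F"
      using Gf by (auto simp: edge_of_def facet_of_def extreme_point_of_def intro: face_of_subset)
  next
    assume F: "F facet_of G \<and> c \<in> F"
    then have FG: "F face_of G" "aff_dim F = 1" using Gf by (auto simp: facet_of_def)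
    then have "F face_of P" "F \<subseteq> G" using Gf(1) face_of_trans face_of_imp_subset by blast+
    moreover have "{c} face_of F"
      using cP F \<open>F face_of P\<close> by (meson empty_subsetI face_of_imp_subset face_of_subset insert_subset)
    ultimately show "F \<in> ?A" using FG(2) by (simp add: edge_of_def face_of_singleton)
  qed
  have pair: "flag_sign P c F1 G = - flag_sign P c F2 G" "flag_sign P c F1 G \<noteq> 0"
    if F: "F1 \<in> ?A" "F2 \<in> ?A" "F1 \<noteq> F2" for F1 F2
  proof -
    have int: "F1 \<inter> F2 = {c}"
      by (rule ridge_facet_Int[OF \<open>{c} face_of G\<close>]) (use F A Gf in auto)
    have ex: "\<exists>d. d \<in> F - {c}" if "F \<in> ?A" for F
    proof (rule ccontr)
      assume "\<not> ?thesis"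
      then have "F = {c}" using that A by blast
      then show False using that by (simp add: edge_of_def)
    qed
    obtain d1 d2 where d: "d1 \<in> F1 - {c}" "d2 \<in> F2 - {c}" using ex F by meson
    then have d': "d2 \<in> G - F1" "d1 \<in> G - F2" using F int by blast+
    have E: "F1 edge_of P" "F1 \<subseteq> G" "c extreme_point_of F1"
      "F2 edge_of P" "F2 \<subseteq> G" "c extreme_point_of F2" using F by auto
    note s1 = flag_sign[OF P dim E(1) G E(2,3) d(1) d'(1)]
    note s2 = flag_sign[OF P dim E(4) G E(5,6) d(2) d'(2)]
    have "cross3 (c - d1) n \<bullet> (d2 - c) = - (cross3 (c - d2) n \<bullet> (d1 - c))" for n
      by (simp add: cross3_simps)
    then show "flag_sign P c F1 G = - flag_sign P c F2 G"
      unfolding s1(1) s2(1) by (simp add: sgn_minus)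
    show "flag_sign P c F1 G \<noteq> 0" by (rule s1(2))
  qed
  obtain F1 F2 where F: "F1 \<in> ?A" "F2 \<in> ?A" "F1 \<noteq> F2"
  proof -
    obtain F1 F2 where "F1 facet_of G" "F2 facet_of G" "F1 \<noteq> F2" "F1 \<inter> F2 = {c}"
      using ridge_two_facets[OF Gf(4) \<open>{c} face_of G\<close>] Gf(3) by auto
    then show ?thesis using that A by blast
  qed
  have "?A = {F1, F2}"
  proof (rule ccontr)
    assume "?A \<noteq> {F1, F2}"
    then obtain F3 where F3: "F3 \<in> ?A" "F3 \<noteq> F1" "F3 \<noteq> F2" using F by blast
    show False
      using pair[OF F] pair(1)[OF F(1) F3(1)] pair(1)[OF F(2) F3(1)] F3(2,3)[symmetric] by linarith
  qed
  then show ?thesis using pair(1)[OF F] F(3) by simp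
qed

section \<open>Integrals over edges and over arcs of normals\<close>

lemma DERIV_power_divide:
  fixes g :: "real \<Rightarrow> real"
  assumes "(g has_real_derivative g') (at t)"
  shows "((\<lambda>t. g t ^ (n + 1) / (n + 1)) has_real_derivative g' * g t ^ n) (at t)"
  using DERIV_cdivide[OF DERIV_power_Suc[OF assms, of n], of "real n + 1"]
  by (simp add: add.commute)

text \<open>
  Along the segment, \<open>v \<bullet> y\<close> is the derivative of \<open>x \<bullet> y\<close>, so the integrand has a power of
  \<open>x \<bullet> y\<close> as primitive.
\<close>

lemma integral_segment_power:
  fixes a b y :: "real^3"
  assumes ab: "a \<noteq> b" and v: "v = (b - a) /\<^sub>R norm (b - a)"
  shows "(v \<bullet> y) * (LINT x:closed_segment a b|hausdorff_measure 1. (x \<bullet> y) ^ r)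
    = length_factor * (((b \<bullet> y) ^ (r + 1) - (a \<bullet> y) ^ (r + 1)) / (r + 1))"
proof -
  define \<gamma> where "\<gamma> t = a + t *\<^sub>R v" for t
  let ?L = "norm (b - a)"
  have norm_v: "norm v = 1" and vL: "?L *\<^sub>R v = b - a" using ab v by simp_all
  have deriv: "(\<gamma> has_vector_derivative v) (at t)" for t
    unfolding \<gamma>_def by (auto intro!: derivative_eq_intros)
  have image: "\<gamma> ` {0..?L} = closed_segment a b"
  proof -
    have "{0..?L} = (\<lambda>u. ?L * u) ` {0..1}"
      using ab image_mult_atLeastAtMost[of ?L 0 1] by simp
    moreover have "\<gamma> (?L * u) = (1 - u) *\<^sub>R a + u *\<^sub>R b" for u
    proof -
      have "(?L * u) *\<^sub>R v = u *\<^sub>R (b - a)" by (metis vL scaleR_scaleR mult.commute)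
      then show ?thesis by (simp add: \<gamma>_def algebra_simps)
    qed
    ultimately show ?thesis by (simp add: closed_segment_image_interval image_image)
  qed
  have inj: "inj_on \<gamma> {0..?L}" using norm_v by (auto simp: inj_on_def \<gamma>_def)
  have cont: "continuous_on UNIV (\<lambda>x. (x \<bullet> y) ^ r)" by (intro continuous_intros)
  define \<Phi> where "\<Phi> t = (\<gamma> t \<bullet> y) ^ (r + 1) / (r + 1)" for t
  have "((\<lambda>t. \<gamma> t \<bullet> y) has_real_derivative v \<bullet> y) (at t)" for t
    unfolding \<gamma>_def by (auto intro!: derivative_eq_intros simp: inner_add_left)
  then have "(\<Phi> has_real_derivative (v \<bullet> y) * (\<gamma> t \<bullet> y) ^ r) (at t)" for t
    unfolding \<Phi>_def by (rule DERIV_power_divide)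
  then have "(LBINT t. ((v \<bullet> y) * (\<gamma> t \<bullet> y) ^ r) * indicator {0..?L} t) = \<Phi> ?L - \<Phi> 0"
    by (intro integral_FTC_Icc_real) (auto simp: \<gamma>_def intro!: continuous_intros)
  also have "(LBINT t. ((v \<bullet> y) * (\<gamma> t \<bullet> y) ^ r) * indicator {0..?L} t)
      = (v \<bullet> y) * (LBINT t:{0..?L}. (\<gamma> t \<bullet> y) ^ r)"
    unfolding set_lebesgue_integral_def
    by (subst integral_mult_right_zero[symmetric]) (simp add: mult_ac)
  also have "\<Phi> ?L - \<Phi> 0 = ((b \<bullet> y) ^ (r + 1) - (a \<bullet> y) ^ (r + 1)) / (r + 1)"
    by (simp add: \<Phi>_def \<gamma>_def vL diff_divide_distrib)
  finally have *: "(v \<bullet> y) * (LBINT t:{0..?L}. (\<gamma> t \<bullet> y) ^ r)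
      = ((b \<bullet> y) ^ (r + 1) - (a \<bullet> y) ^ (r + 1)) / (r + 1)" .
  show ?thesis
    unfolding *[symmetric] image[symmetric]
    by (subst integral_hausdorff_curve[OF deriv norm_v inj _ cont]) simp_all
qed

text \<open>
  The unit vectors orthogonal to \<open>v\<close> form a circle, traversed at unit speed with velocity
  \<open>cross3 v u\<close> at \<open>u\<close>. Hence here, too, the integrand is a derivative.
\<close>

lemma integral_arc_power:
  fixes v e y :: "real^3"
  assumes v: "norm v = 1" and e: "norm e = 1" and ve: "v \<bullet> e = 0" and \<theta>: "0 \<le> \<theta>" "\<theta> \<le> pi"
    and \<gamma>: "\<gamma> = (\<lambda>t. cos t *\<^sub>R e + sin t *\<^sub>R cross3 v e)"
  shows "(LINT u:\<gamma> ` {0..\<theta>}|hausdorff_measure 1. (cross3 v u \<bullet> y) * (u \<bullet> y) ^ s)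
    = length_factor * (((\<gamma> \<theta> \<bullet> y) ^ (s + 1) - (e \<bullet> y) ^ (s + 1)) / (s + 1))"
proof -
  have f: "norm (cross3 v e) = 1" using v e ve by (rule norm_cross3_orthonormal)
  have vv: "cross3 v (cross3 v e) = - e"
    using v ve by (simp add: Lagrange dot_square_norm)
  define \<gamma>' where "\<gamma>' t = cross3 v (\<gamma> t)" for t
  have \<gamma>'_eq: "\<gamma>' t = (- sin t) *\<^sub>R e + cos t *\<^sub>R cross3 v e" for t
    by (simp add: \<gamma>'_def \<gamma> cross_add_right cross_mult_right vv)
  have deriv: "(\<gamma> has_vector_derivative \<gamma>' t) (at t)" for t
    unfolding \<gamma> \<gamma>'_eq by (auto intro!: derivative_eq_intros)
  have orth: "e \<bullet> cross3 v e = 0" "cross3 v e \<bullet> e = 0" by (simp_all add: dot_cross_self)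
  have unit: "norm (\<gamma>' t) = 1" for t
  proof -
    have "(norm (\<gamma>' t))\<^sup>2 = 1"
      unfolding \<gamma>'_eq norm_orthonormal_combination[OF e f orth(1)] by simp
    then show ?thesis by (simp add: power2_eq_1_iff) (smt (verit) norm_ge_zero)
  qed
  have "\<gamma> t \<bullet> e = cos t" for t
    using e orth by (simp add: \<gamma> inner_add_left dot_square_norm)
  then have inj: "inj_on \<gamma> {0..\<theta>}"
    using \<theta> by (intro inj_onI) (metis atLeastAtMost_iff cos_inj_pi order_trans)
  have cont: "continuous_on UNIV (\<lambda>u. (cross3 v u \<bullet> y) * (u \<bullet> y) ^ s)"
    by (intro continuous_intros continuous_on_cross)
  define \<Phi> where "\<Phi> t = (\<gamma> t \<bullet> y) ^ (s + 1) / (s + 1)" for t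
  have \<gamma>y: "((\<lambda>t. \<gamma> t \<bullet> y) has_real_derivative \<gamma>' t \<bullet> y) (at t)" for t
    using bounded_linear.has_vector_derivative[OF bounded_linear_inner_left deriv]
    by (simp add: has_real_derivative_iff_has_vector_derivative)
  have "(\<Phi> has_real_derivative (\<gamma>' t \<bullet> y) * (\<gamma> t \<bullet> y) ^ s) (at t)" for t
    unfolding \<Phi>_def by (rule DERIV_power_divide[OF \<gamma>y])
  then have "(LBINT t. ((\<gamma>' t \<bullet> y) * (\<gamma> t \<bullet> y) ^ s) * indicator {0..\<theta>} t) = \<Phi> \<theta> - \<Phi> 0"
    using \<theta> by (intro integral_FTC_Icc_real) (auto simp: \<gamma>'_eq \<gamma> intro!: continuous_intros)
  then have *: "(LBINT t:{0..\<theta>}. (cross3 v (\<gamma> t) \<bullet> y) * (\<gamma> t \<bullet> y) ^ s) = \<Phi> \<theta> - \<Phi> 0"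
    unfolding \<gamma>'_def set_lebesgue_integral_def by (simp add: mult_ac)
  have "\<Phi> \<theta> - \<Phi> 0 = ((\<gamma> \<theta> \<bullet> y) ^ (s + 1) - (e \<bullet> y) ^ (s + 1)) / (s + 1)"
    by (simp add: \<Phi>_def \<gamma> diff_divide_distrib)
  then show ?thesis
    by (subst integral_hausdorff_curve[OF deriv unit inj \<theta>(1) cont]) (simp only: *)
qed

text \<open>
  In the plane orthogonal to \<open>v\<close>, let \<open>\<theta>\<close> be the angle between \<open>m\<close> and \<open>n\<close>. The vector at angle
  \<open>t\<close> is \<open>(sin (\<theta> - t) / sin \<theta>) m + (sin t / sin \<theta>) n\<close>, and for \<open>- pi < t \<le> pi\<close> both coefficients
  are nonnegative exactly if \<open>0 \<le> t \<le> \<theta>\<close>.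
\<close>

lemma unit_cone_eq_arc:
  fixes v m n :: "real^3"
  assumes v: "norm v = 1" and m: "norm m = 1" "v \<bullet> m = 0" and n: "norm n = 1" "v \<bullet> n = 0"
    and pos: "cross3 v m \<bullet> n > 0" and \<gamma>: "\<gamma> = (\<lambda>t. cos t *\<^sub>R m + sin t *\<^sub>R cross3 v m)"
  obtains \<theta> where "0 \<le> \<theta>" "\<theta> \<le> pi" "n = \<gamma> \<theta>"
    "{\<alpha> *\<^sub>R m + \<beta> *\<^sub>R n | \<alpha> \<beta>. 0 \<le> \<alpha> \<and> 0 \<le> \<beta>} \<inter> sphere 0 1 = \<gamma> ` {0..\<theta>}"
proof -
  let ?f = "cross3 v m"
  have f: "norm ?f = 1" using v m by (rule norm_cross3_orthonormal)
  have mf: "m \<bullet> ?f = 0" by (simp add: dot_cross_self)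
  have norm_sq: "(norm (x *\<^sub>R m + z *\<^sub>R ?f))\<^sup>2 = x\<^sup>2 + z\<^sup>2" for x z
    by (rule norm_orthonormal_combination[OF m(1) f mf])
  have polar: "\<exists>t. 0 \<le> t \<and> t \<le> pi \<and> x = cos t \<and> z = sin t"
    if "norm (x *\<^sub>R m + z *\<^sub>R ?f) = 1" "0 \<le> z" for x z
    using norm_sq[of x z] that by (intro sincos_total_pi) auto
  have n_eq: "n = (n \<bullet> m) *\<^sub>R m + (n \<bullet> ?f) *\<^sub>R ?f"
    by (rule orthonormal_expansion[OF v m n(2)])
  obtain \<theta> where \<theta>: "0 \<le> \<theta>" "\<theta> \<le> pi" "n \<bullet> m = cos \<theta>" "n \<bullet> ?f = sin \<theta>"
    using polar[of "n \<bullet> m" "n \<bullet> ?f"] n_eq n(1) pos by (auto simp: inner_commute)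
  have sin_pos: "sin \<theta> > 0" using pos \<theta>(4) by (simp add: inner_commute)
  then have "\<theta> \<noteq> 0" "\<theta> \<noteq> pi" by auto
  then have \<theta>': "0 < \<theta>" "\<theta> < pi" using \<theta> by auto
  have n\<theta>: "n = \<gamma> \<theta>" using n_eq \<theta> by (simp add: \<gamma>)
  have "{\<alpha> *\<^sub>R m + \<beta> *\<^sub>R n | \<alpha> \<beta>. 0 \<le> \<alpha> \<and> 0 \<le> \<beta>} \<inter> sphere 0 1 = \<gamma> ` {0..\<theta>}"
  proof (intro equalityI subsetI)
    fix u assume "u \<in> \<gamma> ` {0..\<theta>}"
    then obtain t where t: "0 \<le> t" "t \<le> \<theta>" "u = \<gamma> t" by auto
    have "norm u = 1"
      using norm_sq[of "cos t" "sin t"] by (simp add: t \<gamma> power2_eq_1_iff) (smt (verit) norm_ge_zero)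
    moreover have "u = (sin (\<theta> - t) / sin \<theta>) *\<^sub>R m + (sin t / sin \<theta>) *\<^sub>R n"
    proof -
      have "(sin (\<theta> - t) / sin \<theta>) *\<^sub>R m + (sin t / sin \<theta>) *\<^sub>R n
          = ((sin (\<theta> - t) + sin t * cos \<theta>) / sin \<theta>) *\<^sub>R m + (sin t / sin \<theta> * sin \<theta>) *\<^sub>R ?f"
        by (simp add: n\<theta> \<gamma> algebra_simps add_divide_distrib)
      also have "(sin (\<theta> - t) + sin t * cos \<theta>) / sin \<theta> = cos t"
        using sin_pos by (simp add: sin_diff)
      finally show ?thesis using sin_pos t by (simp add: \<gamma>)
    qed
    moreover have "0 \<le> sin (\<theta> - t)" "0 \<le> sin t"
      using t \<theta> by (auto intro!: sin_ge_zero)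
    then have "0 \<le> sin (\<theta> - t) / sin \<theta>" "0 \<le> sin t / sin \<theta>"
      using sin_pos by simp_all
    ultimately show "u \<in> {\<alpha> *\<^sub>R m + \<beta> *\<^sub>R n | \<alpha> \<beta>. 0 \<le> \<alpha> \<and> 0 \<le> \<beta>} \<inter> sphere 0 1"
      unfolding Int_iff mem_sphere_0 by blast
  next
    fix u assume "u \<in> {\<alpha> *\<^sub>R m + \<beta> *\<^sub>R n | \<alpha> \<beta>. 0 \<le> \<alpha> \<and> 0 \<le> \<beta>} \<inter> sphere 0 1"
    then obtain \<alpha> \<beta> where u: "u = \<alpha> *\<^sub>R m + \<beta> *\<^sub>R n" "0 \<le> \<alpha>" "0 \<le> \<beta>" "norm u = 1" by auto
    have u_eq: "u = (\<alpha> + \<beta> * cos \<theta>) *\<^sub>R m + (\<beta> * sin \<theta>) *\<^sub>R ?f"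
      by (simp add: u(1) n\<theta> \<gamma> algebra_simps)
    then obtain t where t: "0 \<le> t" "t \<le> pi" "\<alpha> + \<beta> * cos \<theta> = cos t" "\<beta> * sin \<theta> = sin t"
      using polar[of "\<alpha> + \<beta> * cos \<theta>" "\<beta> * sin \<theta>"] u(3,4) sin_pos by auto
    have "t \<le> \<theta>"
    proof (rule ccontr)
      assume "\<not> t \<le> \<theta>"
      then have "sin (t - \<theta>) > 0" using t \<theta>' by (intro sin_gt_zero) auto
      moreover have "sin (t - \<theta>) = - (\<alpha> * sin \<theta>)"
        by (simp add: sin_diff t(3,4)[symmetric] algebra_simps)
      ultimately show False using u(2) sin_pos by (simp add: mult_less_0_iff)
    qed
    then show "u \<in> \<gamma> ` {0..\<theta>}" using u_eq t by (auto simp: \<gamma>)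
  qed
  then show thesis using that \<theta> n\<theta> by blast
qed

text \<open>
  Up to constants, the integral over the edge is the difference of the values of \<open>(c \<bullet> y) ^ (r + 1)\<close>
  at its two vertices, and the integral over the normals is the difference of the values of
  \<open>(n \<bullet> y) ^ (s + 1)\<close> at the normals of its two facets. The product has four terms, one for each
  flag that contains the edge, and their signs are the flag signs.
\<close>

lemma edge_integral_eq_flag_sum:
  assumes P: "polytope P" and dim: "aff_dim P = 3" and F: "F edge_of P"
  shows "(edge_direction F \<bullet> y) * (LINT x:F|hausdorff_measure 1. (x \<bullet> y) ^ r)
        * (LINT u:unit_normals P F|hausdorff_measure 1. (cross3 (edge_direction F) u \<bullet> y) * (u \<bullet> y) ^ s)
    = length_factor\<^sup>2 / (real (r + 1) * real (s + 1)) *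
      (\<Sum>(G, c) | G facet_of P \<and> F \<subseteq> G \<and> c extreme_point_of F.
         flag_sign P c F G * (c \<bullet> y) ^ (r + 1) * (facet_normal P G \<bullet> y) ^ (s + 1))"
proof -
  obtain a b where ab: "a \<noteq> b" "F = closed_segment a b" "edge_direction F = (b - a) /\<^sub>R norm (b - a)"
    using edge_eq_segment[OF P F] .
  define v where "v = (b - a) /\<^sub>R norm (b - a)"
  let ?n = "facet_normal P"
  obtain G1 G2 where G: "G1 \<noteq> G2" "{G. G facet_of P \<and> F \<subseteq> G} = {G1, G2}"
    "cross3 v (?n G1) \<bullet> ?n G2 > 0" "v \<bullet> ?n G1 = 0" "v \<bullet> ?n G2 = 0"
    "normal_cone P F = {\<alpha> *\<^sub>R ?n G1 + \<beta> *\<^sub>R ?n G2 | \<alpha> \<beta>. 0 \<le> \<alpha> \<and> 0 \<le> \<beta>}"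
    "\<And>p. p \<in> G1 - F \<Longrightarrow> cross3 v (?n G1) \<bullet> (p - a) < 0"
    "\<And>p. p \<in> G2 - F \<Longrightarrow> cross3 v (?n G2) \<bullet> (p - a) > 0"
    by (rule edge_facet_pair[OF P dim F ab(2,1) v_def]) (rule that)
  have facet: "G1 facet_of P" "G2 facet_of P" "F \<subseteq> G1" "F \<subseteq> G2" using G(2) by blast+
  have "aff_dim F = 1" "aff_dim G1 = 2" "aff_dim G2 = 2"
    using F facet dim by (auto simp: edge_of_def facet_of_def)
  then obtain p1 p2 where p: "p1 \<in> G1 - F" "p2 \<in> G2 - F"
    using facet(3,4) by (metis DiffI one_eq_numeral_iff semiring_norm(85) subsetI subset_antisym)
  have signs: "flag_sign P b F G1 = -1" "flag_sign P a F G1 = 1"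
    "flag_sign P b F G2 = 1" "flag_sign P a F G2 = -1"
    using flag_sign_segment(3,4)[OF ab(1) v_def, of G1 P "-1" p1]
      flag_sign_segment(3,4)[OF ab(1) v_def, of G2 P 1 p2] G(7,8) p
    unfolding ab(2) by auto
  have norm_v: "norm v = 1" using ab by (simp add: v_def)
  define \<gamma> where "\<gamma> = (\<lambda>t. cos t *\<^sub>R ?n G1 + sin t *\<^sub>R cross3 v (?n G1))"
  obtain \<theta> where \<theta>: "0 \<le> \<theta>" "\<theta> \<le> pi" "?n G2 = \<gamma> \<theta>"
    "{\<alpha> *\<^sub>R ?n G1 + \<beta> *\<^sub>R ?n G2 | \<alpha> \<beta>. 0 \<le> \<alpha> \<and> 0 \<le> \<beta>} \<inter> sphere 0 1 = \<gamma> ` {0..\<theta>}"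
    by (rule unit_cone_eq_arc[OF norm_v norm_facet_normal[OF P facet(1)] G(4)
          norm_facet_normal[OF P facet(2)] G(5,3) \<gamma>_def]) (rule that)
  have normals: "unit_normals P F = \<gamma> ` {0..\<theta>}"
    unfolding unit_normals_def G(6) by (rule \<theta>(4))
  have arc: "(LINT u:unit_normals P F|hausdorff_measure 1. (cross3 v u \<bullet> y) * (u \<bullet> y) ^ s)
      = length_factor * (((?n G2 \<bullet> y) ^ (s + 1) - (?n G1 \<bullet> y) ^ (s + 1)) / (s + 1))"
    unfolding normals \<theta>(3)
    by (rule integral_arc_power[OF norm_v norm_facet_normal[OF P facet(1)] G(4) \<theta>(1,2) \<gamma>_def])
  have "{(G, c). G facet_of P \<and> F \<subseteq> G \<and> c extreme_point_of F} = {G1, G2} \<times> {a, b}"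
    using G(2) ab(1,2) by (auto simp: extreme_point_of_segment)
  then have "(\<Sum>(G, c) | G facet_of P \<and> F \<subseteq> G \<and> c extreme_point_of F.
         flag_sign P c F G * (c \<bullet> y) ^ (r + 1) * (?n G \<bullet> y) ^ (s + 1))
      = (\<Sum>G\<in>{G1, G2}. \<Sum>c\<in>{a, b}. flag_sign P c F G * (c \<bullet> y) ^ (r + 1) * (?n G \<bullet> y) ^ (s + 1))"
    by (simp add: sum.cartesian_product case_prod_unfold)
  also have "\<dots> = ((b \<bullet> y) ^ (r + 1) - (a \<bullet> y) ^ (r + 1)) * ((?n G2 \<bullet> y) ^ (s + 1) - (?n G1 \<bullet> y) ^ (s + 1))"
    using G(1) ab(1) by (simp add: signs algebra_simps)
  finally have sum_eq: "(\<Sum>(G, c) | G facet_of P \<and> F \<subseteq> G \<and> c extreme_point_of F.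
         flag_sign P c F G * (c \<bullet> y) ^ (r + 1) * (?n G \<bullet> y) ^ (s + 1)) = \<dots>" .
  have "edge_direction F = v" using ab(3) v_def by simp
  then have seg: "(edge_direction F \<bullet> y) * (LINT x:F|hausdorff_measure 1. (x \<bullet> y) ^ r)
      = length_factor * (((b \<bullet> y) ^ (r + 1) - (a \<bullet> y) ^ (r + 1)) / (r + 1))"
    using integral_segment_power[OF ab(1) v_def, of y r] by (simp only: ab(2))
  have "l * (A / p) * (l * (B / q)) = l\<^sup>2 / (p * q) * (A * B)" for l A B p q :: real
    by (simp add: power2_eq_square)
  then show ?thesis
    unfolding sum_eq seg by (simp only: \<open>edge_direction F = v\<close> arc)
qed

section \<open>Vanishing on polytopes and on convex bodies\<close>

text \<open>
  In the sum over all flags, the edges are summed first: the other factors depend only on the vertex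
  and the facet.
\<close>

lemma phi_polytope_diagonal_eq_0:
  assumes P: "polytope P" and dim: "aff_dim P = 3"
  shows "phi_polytope r s P Sigma3 (replicate (r + s + 2) y) = 0"
proof -
  let ?E = "{F. F edge_of P}"
  let ?B = "{G. G facet_of P} \<times> {c. c extreme_point_of P}"
  let ?w = "\<lambda>F (G, c). flag_sign P c F G * (c \<bullet> y) ^ (r + 1) * (facet_normal P G \<bullet> y) ^ (s + 1)"
  let ?R = "\<lambda>F (G, c). F \<subseteq> G \<and> c extreme_point_of F"
  have fin: "finite ?E" "finite ?B"
    using finite_polytope_faces[OF P] finite_polytope_facets[OF P]
      finite_polyhedron_extreme_points[OF polytope_imp_polyhedron[OF P]]
    by (auto simp: edge_of_def elim: finite_subset[rotated])
  have flags: "{(G, c). G facet_of P \<and> F \<subseteq> G \<and> c extreme_point_of F} = {f. f \<in> ?B \<and> ?R F f}"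
    if "F edge_of P" for F
    using that extreme_point_of_face by (auto simp: edge_of_def)
  have "phi_polytope r s P Sigma3 (replicate (r + s + 2) y)
      = (\<Sum>F\<in>?E. length_factor\<^sup>2 / (real (r + 1) * real (s + 1)) * (\<Sum>f | f \<in> ?B \<and> ?R F f. ?w F f))"
    unfolding phi_polytope_diagonal
    by (intro sum.cong refl) (simp only: mem_Collect_eq edge_integral_eq_flag_sum[OF P dim] flags)
  also have "\<dots> = length_factor\<^sup>2 / (real (r + 1) * real (s + 1)) * (\<Sum>F\<in>?E. \<Sum>f | f \<in> ?B \<and> ?R F f. ?w F f)"
    by (simp add: sum_distrib_left)
  also have "(\<Sum>F\<in>?E. \<Sum>f | f \<in> ?B \<and> ?R F f. ?w F f) = (\<Sum>f\<in>?B. \<Sum>F | F \<in> ?E \<and> ?R F f. ?w F f)"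
    by (rule sum.swap_restrict[OF fin])
  also have "\<dots> = 0"
  proof (rule sum.neutral, rule ballI)
    fix f assume "f \<in> ?B"
    then obtain G c where f: "f = (G, c)" and G: "G facet_of P" by auto
    have "(\<Sum>F | F \<in> ?E \<and> ?R F (G, c). ?w F (G, c))
        = (\<Sum>F | F edge_of P \<and> F \<subseteq> G \<and> c extreme_point_of F. flag_sign P c F G)
          * ((c \<bullet> y) ^ (r + 1) * (facet_normal P G \<bullet> y) ^ (s + 1))"
      by (simp add: sum_distrib_right mult.assoc)
    then show "(\<Sum>F | F \<in> ?E \<and> ?R F f. ?w F f) = 0"
      by (simp only: f flag_signs_cancel[OF P dim G] mult_zero_left)
  qed
  finally show ?thesis by simp
qed

text \<open>
  The convex hull of a finite \<open>\<epsilon>\<close>-net of \<open>K\<close> is close to \<open>K\<close>. Adding points at distance \<open>\<epsilon>\<close> from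
  a point of the net, in the directions of a basis, makes it full-dimensional.
\<close>

lemma approximating_polytope:
  fixes K :: "'a::euclidean_space set"
  assumes K: "K \<noteq> {}" "compact K" "convex K" and \<epsilon>: "\<epsilon> > 0"
  obtains P where "P \<noteq> {}" "polytope P" "aff_dim P = int DIM('a)" "hausdorff_dist P K \<le> \<epsilon>"
proof -
  obtain S where S: "finite S" "S \<subseteq> K" "K \<subseteq> (\<Union>x\<in>S. ball x \<epsilon>)"
    using K(2) \<epsilon> compactE_image[of K K "\<lambda>x. ball x \<epsilon>"] by (metis UN_I centre_in_ball open_ball subsetI)
  then obtain x0 where x0: "x0 \<in> S" using K(1) by fastforce
  define B where "B = (\<lambda>b. x0 + \<epsilon> *\<^sub>R b) ` Basis"
  define P where "P = convex hull (S \<union> B)"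
  have P: "polytope P" "P \<noteq> {}" and SP: "S \<subseteq> P"
    using S(1) x0 by (auto simp: P_def B_def hull_inc intro: polytope_convex_hull)
  have "span ((\<lambda>x. - x0 + x) ` (S \<union> B)) = UNIV"
  proof -
    have "b \<in> span ((\<lambda>x. - x0 + x) ` (S \<union> B))" if "b \<in> Basis" for b
    proof -
      have "- x0 + (x0 + \<epsilon> *\<^sub>R b) \<in> (\<lambda>x. - x0 + x) ` (S \<union> B)"
        using that by (intro imageI) (auto simp: B_def)
      then have "\<epsilon> *\<^sub>R b \<in> span ((\<lambda>x. - x0 + x) ` (S \<union> B))" by (simp add: span_base)
      from span_scale[OF this, of "1 / \<epsilon>"] show ?thesis using \<epsilon> by simp
    qed
    then show ?thesis by (metis span_Basis span_minimal subsetI subspace_span top.extremum_uniqueI)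
  qed
  then have "aff_dim (S \<union> B) = int DIM('a)"
    using aff_dim_eq_dim[of x0 "S \<union> B"] x0 by (simp add: hull_inc dim_eq_full)
  then have dim: "aff_dim P = int DIM('a)" by (simp only: P_def aff_dim_convex_hull)
  have P_sub: "P \<subseteq> (\<Union>x\<in>K. \<Union>y\<in>cball 0 \<epsilon>. {x + y})"
    unfolding P_def
  proof (rule hull_minimal)
    show "convex (\<Union>x\<in>K. \<Union>y\<in>cball 0 \<epsilon>. {x + y})"
      by (rule convex_sums[OF K(3) convex_cball])
    show "S \<union> B \<subseteq> (\<Union>x\<in>K. \<Union>y\<in>cball 0 \<epsilon>. {x + y})"
    proof
      fix z assume "z \<in> S \<union> B"
      then consider "z \<in> S" | b where "b \<in> Basis" "z = x0 + \<epsilon> *\<^sub>R b" by (auto simp: B_def)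
      then show "z \<in> (\<Union>x\<in>K. \<Union>y\<in>cball 0 \<epsilon>. {x + y})"
      proof cases
        case 1
        then show ?thesis using S(2) \<epsilon> by (intro UN_I[of z K]) (auto intro!: bexI[of _ 0])
      next
        case 2
        then show ?thesis using S(2) x0 \<epsilon> by (intro UN_I[of x0 K]) (auto intro!: bexI[of _ "\<epsilon> *\<^sub>R b"])
      qed
    qed
  qed
  have "infdist z K \<le> \<epsilon>" if z: "z \<in> P" for z
  proof -
    obtain x y where xy: "z = x + y" "x \<in> K" "norm y \<le> \<epsilon>"
      using subsetD[OF P_sub z] by auto
    then show ?thesis using infdist_le2[of x K z \<epsilon>] by (simp add: dist_norm)
  qed
  moreover have "infdist z P \<le> \<epsilon>" if "z \<in> K" for z
  proof -
    obtain x where "x \<in> S" "dist x z < \<epsilon>" using subsetD[OF S(3) \<open>z \<in> K\<close>] by auto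
    then show ?thesis using infdist_le2[of x P z \<epsilon>] SP by (auto simp: dist_commute)
  qed
  ultimately have "hausdorff_dist P K \<le> \<epsilon>"
    unfolding hausdorff_dist_def using K(1) P(2) by (auto intro!: cSUP_least)
  then show thesis using that P dim by blast
qed

lemma hausdorff_dist_nonneg:
  fixes K L :: "'a::euclidean_space set"
  assumes "compact K" "K \<noteq> {}" "L \<noteq> {}"
  shows "0 \<le> hausdorff_dist K L"
proof -
  obtain x where x: "x \<in> K" using assms by blast
  have "bdd_above ((\<lambda>x. infdist x L) ` K)"
    using assms by (intro bounded_imp_bdd_above compact_imp_bounded compact_continuous_image
        continuous_intros)
  then have "infdist x L \<le> (SUP x\<in>K. infdist x L)" using x by (rule cSUP_upper[rotated])
  then show ?thesis
    using infdist_nonneg[of x L] unfolding hausdorff_dist_def by linarith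
qed

theorem proposition2:
  fixes r s :: nat
    and \<phi> :: "(real^3) set \<Rightarrow> ((real^3) \<times> (real^3)) set \<Rightarrow> tensor"
    and T :: "(real^3) set \<Rightarrow> tensor"
  assumes "weakly_continuous_extension r s \<phi>"
    and "\<And>K. K \<in> convex_bodies \<Longrightarrow> T K = \<phi> K Sigma3"
  shows "\<forall>K\<in>convex_bodies. T K = (\<lambda>ys. 0)"
proof
  fix K :: "(real^3) set" assume K: "K \<in> convex_bodies"
  let ?p = "r + s + 2"
  have Sigma3: "space Sigma3_borel = Sigma3" "Sigma3 \<in> sets Sigma3_borel"
    using sets.top[of Sigma3_borel] by (auto simp: Sigma3_borel_def space_restrict_space)
  have ext: "tensor_measure ?p (\<phi> K)" "weakly_continuous \<phi>"
    "\<And>P \<eta>. P \<in> polytopes \<Longrightarrow> \<eta> \<in> sets Sigma3_borel \<Longrightarrow> \<phi> P \<eta> = phi_polytope r s P \<eta>"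
    using assms(1) K unfolding weakly_continuous_extension_def by auto
  have "\<exists>P. P \<noteq> {} \<and> polytope P \<and> aff_dim P = 3 \<and> hausdorff_dist P K \<le> 1 / Suc i" for i :: nat
  proof (rule approximating_polytope[of K "1 / Suc i"])
  qed (use K in \<open>auto simp: convex_bodies_def\<close>)
  then obtain P where P: "\<And>i::nat. P i \<noteq> {}" "\<And>i. polytope (P i)" "\<And>i. aff_dim (P i) = 3"
    "\<And>i. hausdorff_dist (P i) K \<le> 1 / Suc i" by metis
  have bodies: "P i \<in> convex_bodies" "P i \<in> polytopes" for i
    using P(1,2)[of i] by (auto simp: convex_bodies_def polytopes_def polytope_imp_compact polytope_imp_convex)
  have "(\<lambda>i. hausdorff_dist (P i) K) \<longlonglongrightarrow> 0"
  proof (rule tendsto_sandwich[OF _ _ tendsto_const LIMSEQ_inverse_real_of_nat])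
    show "\<forall>\<^sub>F i in sequentially. 0 \<le> hausdorff_dist (P i) K"
      using K bodies(1) by (auto simp: convex_bodies_def intro!: always_eventually hausdorff_dist_nonneg)
    show "\<forall>\<^sub>F i in sequentially. hausdorff_dist (P i) K \<le> inverse (real (Suc i))"
      using P(4) by (auto simp: inverse_eq_divide)
  qed
  then have conv: "\<forall>f ys. continuous_on Sigma3 f \<longrightarrow>
      (\<exists>I J. (\<forall>i. has_signed_integral Sigma3_borel (\<lambda>\<eta>. \<phi> (P i) \<eta> ys) f (I i)) \<and>
         has_signed_integral Sigma3_borel (\<lambda>\<eta>. \<phi> K \<eta> ys) f J \<and> I \<longlonglongrightarrow> J)"
    using ext(2) K bodies(1) unfolding weakly_continuous_def by blast
  have "\<phi> K Sigma3 (replicate ?p y) = 0" for y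
  proof -
    obtain I J where I: "\<And>i. has_signed_integral Sigma3_borel (\<lambda>\<eta>. \<phi> (P i) \<eta> (replicate ?p y)) (\<lambda>_. 1) (I i)"
      and J: "has_signed_integral Sigma3_borel (\<lambda>\<eta>. \<phi> K \<eta> (replicate ?p y)) (\<lambda>_. 1) J" and "I \<longlonglongrightarrow> J"
      using conv[rule_format, OF continuous_on_const[of _ 1], of "replicate ?p y"] by blast
    have "I = (\<lambda>_. 0)"
    proof
      fix i show "I i = 0"
        using has_signed_integral_one[OF I[of i]] ext(3)[OF bodies(2) Sigma3(2), of i]
          phi_polytope_diagonal_eq_0[OF P(2,3), of r s i y] by (simp only: Sigma3(1))
    qed
    then have "J = 0" using \<open>I \<longlonglongrightarrow> J\<close> by (simp add: LIMSEQ_const_iff)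
    then show ?thesis using has_signed_integral_one[OF J] by (simp only: Sigma3(1))
  qed
  moreover have "\<phi> K Sigma3 \<in> sym_tensors ?p"
    using ext(1) Sigma3(2) unfolding tensor_measure_def by blast
  ultimately show "T K = (\<lambda>ys. 0)"
    using assms(2)[OF K] sym_tensor_eq_0_if_diagonal_0[of "\<phi> K Sigma3" ?p] by auto
qed

end
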